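(* There is an absolute constant $C>0$ such that the following holds. Let $k,t\ge 1$ be integers, let $n=kt$, and let $c\colon E(K_{2n})\to[k]$ be a colour-balanced $k$-edge-colouring of the complete graph $K_{2n}$. Then there exists a perfect matching $M$ of $K_{2n}$ satisfying $$ f_c(M)=\sum_{i=1}^k \bigl|\,|c^{-1}(i)\cap M|-t\,\bigr| \le C k^2. $$
   Context: $[k]=\{1,\dots,k\}$. A $k$-edge-colouring $c\colon E(G)\to[k]$ of a graph $G$ is an arbitrary (not necessarily proper) assignment of colours to edges. It is colour-balanced if $|c^{-1}(i)|=|c^{-1}(j)|$ for all $i,j\in[k]$. A matching is identified with its set of edges. *)

theory Defs
  imports Complex_Main "HOL-Library.FuncSet" "HOL-Library.Ramsey"
begin

text \<open>
  Finite simple graphs are given by a vertex set \<open>V\<close> and a set \<open>E\<close> of two-element subsets of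
  \<open>V\<close>.
\<close>

abbreviation complete_verts :: "nat \<Rightarrow> nat set" where
  "complete_verts m \<equiv> {1..m}"

definition complete_edges :: "nat \<Rightarrow> nat set set" where
  "complete_edges m = nsets (complete_verts m) 2"

text \<open>
  Colourings are total functions in HOL; only their values on \<open>E\<close> matter, so preimages are
  intersected with \<open>E\<close>.
\<close>

definition edge_colouring :: "'a set set \<Rightarrow> nat \<Rightarrow> ('a set \<Rightarrow> nat) \<Rightarrow> bool" where
  "edge_colouring E k c \<longleftrightarrow> c \<in> E \<rightarrow> {1..k}"

definition colour_class :: "'a set set \<Rightarrow> ('a set \<Rightarrow> nat) \<Rightarrow> nat \<Rightarrow> 'a set set" where
  "colour_class E c i = c -` {i} \<inter> E"

definition colour_balanced :: "'a set set \<Rightarrow> nat \<Rightarrow> ('a set \<Rightarrow> nat) \<Rightarrow> bool" where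
  "colour_balanced E k c \<longleftrightarrow>
     (\<forall>i\<in>{1..k}. \<forall>j\<in>{1..k}. card (colour_class E c i) = card (colour_class E c j))"

definition matching :: "'a set set \<Rightarrow> 'a set set \<Rightarrow> bool" where
  "matching E M \<longleftrightarrow> M \<subseteq> E \<and> pairwise disjnt M"

definition perfect_matching :: "'a set \<Rightarrow> 'a set set \<Rightarrow> 'a set set \<Rightarrow> bool" where
  "perfect_matching V E M \<longleftrightarrow> matching E M \<and> \<Union>M = V"

definition colour_deviation ::
    "'a set set \<Rightarrow> nat \<Rightarrow> nat \<Rightarrow> ('a set \<Rightarrow> nat) \<Rightarrow> 'a set set \<Rightarrow> real" where
  "colour_deviation E k t c M =
     (\<Sum>i=1..k. \<bar>real (card (colour_class E c i \<inter> M)) - real t\<bar>)"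

end

theory Submission
  imports Defs "HOL-Analysis.Analysis"
begin

text \<open>
  Encode a perfect matching as a fixed-point-free involution and let \<open>d\<close> be its vector of colour
  excesses. A switch replaces two matching edges by two others on the same four vertices. Because the
  colouring is balanced, the average effect of a switch is a negative multiple of \<open>d\<close>, so in every
  direction \<open>u\<close> the sum of \<open>max 0 (u \<bullet> \<delta>)\<close> over the effects \<open>\<delta>\<close> of all switches is at least of order
  \<open>n (- u \<bullet> d)\<close>; vertex-disjoint switches can retain a fraction of order \<open>1 / n\<close> of it.

  For a finite set \<open>N\<close> of directions, a greedy choice with an exponential potential gives vertex-disjoint
  switches that preserve these lower bounds up to a constant factor and an error \<open>O(ln |N|)\<close>.
  The objective is piecewise linear in \<open>u\<close> with only polynomially many (in \<open>k\<close>) walls, so it suffices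
  to test the vertices of an arrangement, and \<open>ln |N| = O(k ln k)\<close>. By duality \<open>- d / 8\<close> lies close to
  the zonotope of the chosen switches. Rounding the coefficients to 0 and 1 costs only \<open>O(k)\<close>,
  as at most \<open>k\<close> of them need to be fractional. The new matching has excess at most
  \<open>7/8 |d| + O(k\<^sup>2)\<close> in the \<open>1\<close>-norm, so an almost optimal matching has excess \<open>O(k\<^sup>2)\<close>.
\<close>

section \<open>Greedy choice of disjoint pairs\<close>

text \<open>The vertices of the two matching edges that a switch at \<open>q\<close> replaces, when
  \<open>p\<close> is the partner map. Switches with disjoint \<open>quad\<close> sets can be
  carried out independently.\<close>

definition quad :: "('a \<Rightarrow> 'a) \<Rightarrow> 'a \<times> 'a \<Rightarrow> 'a set" where
  "quad p q = {fst q, p (fst q), snd q, p (snd q)}"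

lemma exp_le_quadratic:
  fixes x :: real
  assumes "x \<le> 1"
  shows "exp x \<le> 1 + x + x\<^sup>2"
proof (cases "x \<ge> 0")
  case True
  then show ?thesis using exp_bound assms by blast
next
  case False
  define y where "y = - x"
  have y: "y > 0" using False y_def by simp
  \<comment> \<open>The product equals \<open>1 + y ^ 3\<close>.\<close>
  have "1 \<le> (1 - y + y\<^sup>2) * (1 + y)"
    using y by (simp add: algebra_simps power2_eq_square)
  also have "\<dots> \<le> (1 - y + y\<^sup>2) * exp y"
  proof (rule mult_left_mono)
    show "1 + y \<le> exp y" by simp
    have "(1 - y + y\<^sup>2) = (1/2 - y)\<^sup>2 + 3/4" by (simp add: algebra_simps power2_eq_square)
    then show "0 \<le> 1 - y + y\<^sup>2" by simp
  qed
  finally have "exp (- y) \<le> 1 - y + y\<^sup>2"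
    by (simp add: exp_minus field_simps)
  then show ?thesis by (simp add: y_def)
qed

text \<open>Deleting \<open>quad p q\<close> destroys at most the row and column sums at its four
  vertices, and as \<open>p\<close> permutes \<open>R\<close>, the average of \<open>b\<close> is at
  most 8 times that of \<open>y\<close>. The weight 16 on \<open>y\<close> makes the linear term
  negative enough to pay for the quadratic one.\<close>

lemma average_step:
  fixes y :: "'a \<Rightarrow> 'a \<Rightarrow> real"
  assumes fin: "finite R" and p: "p ` R \<subseteq> R" "\<And>a. a \<in> R \<Longrightarrow> p (p a) = a"
    and y0: "\<And>a c. 0 \<le> y a c" and y4: "\<And>a c. y a c \<le> 4"
    and v: "v > 0" "real (card R) \<le> v"
  defines "S \<equiv> \<lambda>T. \<Sum>a\<in>T. \<Sum>c\<in>T. y a c"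
  defines "b \<equiv> \<lambda>q. (S R - S (R - quad p q)) / v"
  shows "(\<Sum>q\<in>R \<times> R. exp ((b q - 16 * y (fst q) (snd q)) / 160)) \<le> real (card (R \<times> R))"
proof -
  define row where "row = (\<lambda>z. (\<Sum>c\<in>R. y z c) + (\<Sum>c\<in>R. y c z))"
  have row0: "row z \<ge> 0" for z unfolding row_def by (intro add_nonneg_nonneg sum_nonneg y0)
  have row8: "row z \<le> 8 * v" for z
  proof -
    have "(\<Sum>c\<in>R. y z c) \<le> real (card R) * 4" "(\<Sum>c\<in>R. y c z) \<le> real (card R) * 4"
      by (intro sum_bounded_above y4)+
    then show ?thesis using v unfolding row_def by linarith
  qed
  define Z where "Z = (\<lambda>q. row (fst q) + row (p (fst q)) + row (snd q) + row (p (snd q)))"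
  have kill: "S R - S (R - D) \<le> (\<Sum>z\<in>D \<inter> R. row z)" for D
  proof -
    have e: "(\<Sum>c\<in>R. f c) = (\<Sum>c\<in>R - D. f c) + (\<Sum>c\<in>D \<inter> R. f c)" for f :: "'a \<Rightarrow> real"
      using sum.Int_Diff[OF fin, of f D] by (simp add: Int_commute add.commute)
    have "S R = (\<Sum>a\<in>R - D. \<Sum>c\<in>R. y a c) + (\<Sum>a\<in>D \<inter> R. \<Sum>c\<in>R. y a c)"
      unfolding S_def by (rule e)
    also have "(\<Sum>a\<in>R - D. \<Sum>c\<in>R. y a c) = S (R - D) + (\<Sum>a\<in>R - D. \<Sum>c\<in>D \<inter> R. y a c)"
      unfolding S_def by (simp add: e sum.distrib)
    also have "(\<Sum>a\<in>R - D. \<Sum>c\<in>D \<inter> R. y a c) \<le> (\<Sum>a\<in>R. \<Sum>c\<in>D \<inter> R. y a c)"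
      using fin by (intro sum_mono2) (auto intro!: sum_nonneg y0)
    also have "\<dots> = (\<Sum>c\<in>D \<inter> R. \<Sum>a\<in>R. y a c)" by (rule sum.swap)
    finally show ?thesis by (simp add: row_def sum.distrib)
  qed
  have S_mono: "S (R - D) \<le> S R" for D
  proof -
    have "S (R - D) \<le> (\<Sum>a\<in>R - D. \<Sum>c\<in>R. y a c)"
      unfolding S_def using fin by (intro sum_mono sum_mono2) (auto intro: y0)
    also have "\<dots> \<le> S R" unfolding S_def using fin
      by (intro sum_mono2) (auto intro!: sum_nonneg y0)
    finally show ?thesis .
  qed
  have b0: "b q \<ge> 0" for q unfolding b_def using S_mono v by simp
  have bZ: "v * b q \<le> Z q" for q
  proof -
    have "(\<Sum>z\<in>quad p q \<inter> R. row z) \<le> (\<Sum>z\<in>quad p q. row z)"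
      by (intro sum_mono2) (auto simp: quad_def row0)
    also have "\<dots> \<le> Z q" unfolding quad_def Z_def
      by (auto simp: sum.insert_if insert_absorb row0 add_nonneg_nonneg add.assoc)
    finally show ?thesis using kill[of "quad p q"] v unfolding b_def by simp
  qed
  \<comment> \<open>Four rows of at most \<open>8 * v\<close> each. The exponent is thus at most
    32/160, within the range of \<open>exp_le_quadratic\<close>.\<close>
  have b32: "b q \<le> 32" for q
  proof -
    have "Z q \<le> 32 * v" unfolding Z_def
      using row8[of "fst q"] row8[of "p (fst q)"] row8[of "snd q"] row8[of "p (snd q)"] by linarith
    then have "v * b q \<le> v * 32" using bZ[of q] by simp
    then show ?thesis using v by simp
  qed
  have bij: "bij_betw p R R"
    by (rule bij_betwI[where g = p]) (use p in auto)
  have rowsum: "(\<Sum>z\<in>R. row z) = 2 * S R"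
    unfolding row_def S_def by (simp add: sum.distrib) (subst sum.swap, simp)
  have rowsum': "(\<Sum>z\<in>R. row (p z)) = 2 * S R"
    using sum.reindex_bij_betw[OF bij, of row] rowsum by simp
  have Zsum: "(\<Sum>q\<in>R \<times> R. Z q) = 8 * real (card R) * S R"
  proof -
    have "(\<Sum>q\<in>R \<times> R. Z q) = (\<Sum>a\<in>R. \<Sum>c\<in>R. row a + row (p a) + row c + row (p c))"
      unfolding Z_def by (simp add: sum.cartesian_product case_prod_unfold)
    also have "\<dots> = 8 * real (card R) * S R"
      by (simp add: sum.distrib rowsum rowsum' flip: sum_distrib_left)
    finally show ?thesis .
  qed
  have ysum: "(\<Sum>q\<in>R \<times> R. y (fst q) (snd q)) = S R"
    unfolding S_def by (simp add: sum.cartesian_product case_prod_unfold)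
  have SR0: "S R \<ge> 0" unfolding S_def by (intro sum_nonneg y0)
  have bsum: "(\<Sum>q\<in>R \<times> R. b q) \<le> 8 * S R"
  proof -
    have "v * (\<Sum>q\<in>R \<times> R. b q) \<le> (\<Sum>q\<in>R \<times> R. Z q)"
      by (simp add: sum_distrib_left bZ sum_mono)
    also have "\<dots> \<le> v * (8 * S R)" unfolding Zsum
      using mult_right_mono[OF v(2), of "8 * S R"] SR0 by (simp add: mult_ac)
    finally show ?thesis using v by simp
  qed
  have step: "exp ((b q - 16 * y (fst q) (snd q)) / 160)
      \<le> 1 + b q * (1/160 + 32/25600) + y (fst q) (snd q) * (1024/25600 - 16/160)" for q
  proof -
    let ?y = "y (fst q) (snd q)"
    let ?x = "(b q - 16 * ?y) / 160"
    have 1: "exp ?x \<le> 1 + ?x + ?x\<^sup>2"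
      using b32[of q] y0[of "fst q" "snd q"] by (intro exp_le_quadratic) simp
    have "(b q - 16 * ?y)\<^sup>2 = b q * b q + 256 * (?y * ?y) - 32 * (b q * ?y)"
      by (simp add: power2_eq_square algebra_simps)
    \<comment> \<open>The upper bounds 32 and 4 make the squares linear; the mixed term has a
      favourable sign and is dropped.\<close>
    also have "\<dots> \<le> 32 * b q + 256 * (4 * ?y) - 0"
      using b0[of q] b32[of q] y0[of "fst q" "snd q"] y4[of "fst q" "snd q"]
      by (intro diff_mono add_mono mult_left_mono mult_right_mono mult_nonneg_nonneg) auto
    finally have "?x\<^sup>2 \<le> (32 * b q + 1024 * ?y) / 25600"
      by (simp add: power_divide)
    with 1 show ?thesis by (simp add: field_simps)
  qed
  have "(\<Sum>q\<in>R \<times> R. exp ((b q - 16 * y (fst q) (snd q)) / 160))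
     \<le> (\<Sum>q\<in>R \<times> R. 1 + b q * (1/160 + 32/25600) + y (fst q) (snd q) * (1024/25600 - 16/160))"
    by (intro sum_mono step)
  also have "\<dots> = real (card (R \<times> R)) + (\<Sum>q\<in>R \<times> R. b q) * (1/160 + 32/25600)
       + S R * (1024/25600 - 16/160)"
    unfolding sum.distrib ysum[symmetric] sum_distrib_right by simp
  \<comment> \<open>The coefficients cancel exactly, 8 times 3/400 against 1/10 - 1/25: with the
    factor 16, the denominator 160 is the smallest for which this estimate works.\<close>
  also have "\<dots> \<le> real (card (R \<times> R))" using bsum SR0 by simp
  finally show ?thesis .
qed

text \<open>
  Choosing a pair destroys the weights of all pairs that meet it. On average the destroyed weight,
  divided by \<open>v\<close>, is at most a fixed multiple of the collected weight. A weighted sum of exponentials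
  over all test functions therefore need not increase in a suitable step, and this controls all
  test functions at once. When no pair is left, everything has been destroyed.
\<close>

lemma greedy_pairs:
  fixes y :: "'u \<Rightarrow> 'a \<Rightarrow> 'a \<Rightarrow> real"
  assumes N: "finite N"
    and y0: "\<And>u a c. u \<in> N \<Longrightarrow> 0 \<le> y u a c" and y4: "\<And>u a c. u \<in> N \<Longrightarrow> y u a c \<le> 4"
    and ydiag: "\<And>u a. y u a a = 0" "\<And>u a. y u a (p a) = 0"
    and v: "v > 0"
  shows "finite R \<Longrightarrow> p ` R \<subseteq> R \<Longrightarrow> (\<And>a. a \<in> R \<Longrightarrow> p (p a) = a) \<Longrightarrow> real (card R) \<le> v \<Longrightarrow>
    (\<And>u. u \<in> N \<Longrightarrow> 0 \<le> w u) \<Longrightarrow>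
    \<exists>Q. Q \<subseteq> R \<times> R \<and> disjoint_family_on (quad p) Q \<and> (\<forall>(a, c)\<in>Q. c \<noteq> a \<and> c \<noteq> p a) \<and>
      (\<Sum>u\<in>N. w u * exp (((\<Sum>a\<in>R. \<Sum>c\<in>R. y u a c) / v - 16 * (\<Sum>(a, c)\<in>Q. y u a c)) / 160))
        \<le> (\<Sum>u\<in>N. w u)"
proof (induction "card R" arbitrary: R w rule: less_induct)
  case less
  define S where "S = (\<lambda>u T. \<Sum>a\<in>T. \<Sum>c\<in>T. y u a c)"
  define b where "b = (\<lambda>u q. (S u R - S u (R - quad p q)) / v)"
  define G where "G = {q \<in> R \<times> R. snd q \<noteq> fst q \<and> snd q \<noteq> p (fst q)}"
  define f where "f = (\<lambda>u q. exp ((b u q - 16 * y u (fst q) (snd q)) / 160))"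
  have finG: "finite G" and GR: "G \<subseteq> R \<times> R" using less.prems(1) by (auto simp: G_def)
  show ?case
  proof (cases "G = {}")
    case True
    have "y u a c = 0" if "a \<in> R" "c \<in> R" for u a c
    proof -
      have "(a, c) \<notin> G" using True by simp
      then show ?thesis using that ydiag by (auto simp: G_def)
    qed
    then show ?thesis
      by (intro exI[of _ "{}"]) (auto simp: disjoint_family_on_def)
  next
    case False
    have avg: "(\<Sum>q\<in>R \<times> R. f u q) \<le> (\<Sum>q\<in>R \<times> R. 1)" if "u \<in> N" for u
      using average_step[of R p "y u" v] less.prems y0[OF that] y4[OF that] v
      unfolding f_def b_def S_def by simp
    \<comment> \<open>Pairs outside \<open>G\<close> collect no weight, so their factors are at
      least 1, and leaving them out cannot raise the average above 1.\<close>
    have avgG: "(\<Sum>q\<in>G. f u q) \<le> (\<Sum>q\<in>G. 1)" if u: "u \<in> N" for u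
    proof -
      have "1 \<le> f u q" if q: "q \<in> R \<times> R - G" for q
      proof -
        have "y u (fst q) (snd q) = 0" using q ydiag unfolding G_def by (cases q) auto
        moreover have "S u (R - quad p q) \<le> S u R"
        proof -
          have "S u (R - quad p q) \<le> (\<Sum>a\<in>R - quad p q. \<Sum>c\<in>R. y u a c)"
            unfolding S_def using less.prems(1) y0[OF u] by (intro sum_mono sum_mono2) auto
          also have "\<dots> \<le> S u R" unfolding S_def using less.prems(1) y0[OF u]
            by (intro sum_mono2) (auto intro!: sum_nonneg)
          finally show ?thesis .
        qed
        ultimately show ?thesis unfolding f_def b_def using v by simp
      qed
      then have "(\<Sum>q\<in>R \<times> R - G. 1) \<le> (\<Sum>q\<in>R \<times> R - G. f u q)" by (rule sum_mono)
      then show ?thesis using avg[OF u] less.prems(1)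
        sum.subset_diff[OF GR, of "f u"] sum.subset_diff[OF GR, of "\<lambda>_. 1::real"] by auto
    qed
    have "(\<Sum>q\<in>G. \<Sum>u\<in>N. w u * f u q) = (\<Sum>u\<in>N. w u * (\<Sum>q\<in>G. f u q))"
      by (subst sum.swap) (simp add: sum_distrib_left)
    also have "\<dots> \<le> (\<Sum>u\<in>N. w u * (\<Sum>q\<in>G. 1))"
      by (intro sum_mono mult_left_mono avgG less.prems)
    also have "\<dots> = (\<Sum>q\<in>G. \<Sum>u\<in>N. w u)" by (subst sum.swap) (simp add: sum_distrib_left mult.commute)
    finally have "\<exists>q\<in>G. (\<Sum>u\<in>N. w u * f u q) \<le> (\<Sum>u\<in>N. w u)"
      using sum_strict_mono[OF finG False, of "\<lambda>_. \<Sum>u\<in>N. w u" "\<lambda>q. \<Sum>u\<in>N. w u * f u q"]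
      by (meson leD not_le_imp_less)
    then obtain q where q: "q \<in> G" and qle: "(\<Sum>u\<in>N. w u * f u q) \<le> (\<Sum>u\<in>N. w u)" by blast
    obtain a c where ac: "q = (a, c)" by (cases q)
    define R' where "R' = R - quad p q"
    have qR: "a \<in> R" "c \<in> R" "c \<noteq> a" "c \<noteq> p a" using q ac by (auto simp: G_def)
    have "R' \<subset> R" using qR ac by (auto simp: R'_def quad_def)
    then have lt: "card R' < card R" using less.prems(1) by (rule psubset_card_mono[rotated])
    have pR': "p ` R' \<subseteq> R'"
    proof
      fix x assume "x \<in> p ` R'"
      then obtain z where z: "z \<in> R" "z \<notin> quad p q" "x = p z" by (auto simp: R'_def)
      have "p x = z" using z less.prems(3) by simp
      then have "x \<notin> quad p q" using z(2) qR less.prems(3) by (auto simp: quad_def ac)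
      then show "x \<in> R'" using z less.prems(2) by (auto simp: R'_def)
    qed
    \<comment> \<open>The weights are updated to \<open>w u * f u q\<close>, so the potential after
      the chosen step is the starting one for \<open>R'\<close>. The normaliser \<open>v\<close>
      stays fixed while \<open>R\<close> shrinks.\<close>
    have IH: "\<exists>Q. Q \<subseteq> R' \<times> R' \<and> disjoint_family_on (quad p) Q \<and> (\<forall>(a, c)\<in>Q. c \<noteq> a \<and> c \<noteq> p a) \<and>
      (\<Sum>u\<in>N. (w u * f u q) * exp ((S u R' / v - 16 * (\<Sum>(a, c)\<in>Q. y u a c)) / 160))
        \<le> (\<Sum>u\<in>N. w u * f u q)"
      unfolding S_def
      by (rule less.hyps[OF lt])
        (use less.prems pR' lt in \<open>auto simp: R'_def f_def\<close>)
    then obtain Q where Q: "Q \<subseteq> R' \<times> R'" "disjoint_family_on (quad p) Q"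
      "\<forall>(a, c)\<in>Q. c \<noteq> a \<and> c \<noteq> p a"
      "(\<Sum>u\<in>N. (w u * f u q) * exp ((S u R' / v - 16 * (\<Sum>(a, c)\<in>Q. y u a c)) / 160))
        \<le> (\<Sum>u\<in>N. w u * f u q)" by blast
    have sub: "quad p r \<subseteq> R'" if "r \<in> Q" for r
      using Q(1) that pR' by (cases r) (auto simp: quad_def)
    have finQ: "finite Q" using Q(1) less.prems(1) by (auto simp: R'_def intro: finite_subset)
    have qQ: "q \<notin> Q" using Q(1) ac by (auto simp: R'_def quad_def)
    have "(\<Sum>u\<in>N. w u * exp ((S u R / v - 16 * (\<Sum>(a, c)\<in>insert q Q. y u a c)) / 160))
      = (\<Sum>u\<in>N. (w u * f u q) * exp ((S u R' / v - 16 * (\<Sum>(a, c)\<in>Q. y u a c)) / 160))"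
    proof (intro sum.cong refl)
      fix u
      \<comment> \<open>The loss telescopes: \<open>b u q\<close> accounts for the drop from
        \<open>S u R\<close> to \<open>S u R'\<close>.\<close>
      have "(S u R / v - 16 * (\<Sum>(a, c)\<in>insert q Q. y u a c)) / 160
         = (b u q - 16 * y u (fst q) (snd q)) / 160 + (S u R' / v - 16 * (\<Sum>(a, c)\<in>Q. y u a c)) / 160"
        using finQ qQ by (simp add: b_def R'_def ac diff_divide_distrib add_divide_distrib)
      then show "w u * exp ((S u R / v - 16 * (\<Sum>(a, c)\<in>insert q Q. y u a c)) / 160)
        = (w u * f u q) * exp ((S u R' / v - 16 * (\<Sum>(a, c)\<in>Q. y u a c)) / 160)"
        by (simp only: f_def exp_add mult.assoc)
    qed
    also have "\<dots> \<le> (\<Sum>u\<in>N. w u)" using Q(4) qle by linarith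
    finally have "(\<Sum>u\<in>N. w u * exp ((S u R / v - 16 * (\<Sum>(a, c)\<in>insert q Q. y u a c)) / 160))
        \<le> (\<Sum>u\<in>N. w u)" .
    moreover have "disjoint_family_on (quad p) (insert q Q)"
      using Q(2) sub qQ by (auto simp: disjoint_family_on_insert R'_def)
    moreover have "insert q Q \<subseteq> R \<times> R" using Q(1) qR ac by (auto simp: R'_def)
    ultimately show ?thesis unfolding S_def using Q(3) ac qR
      by (intro exI[of _ "insert q Q"]) auto
  qed
qed

text \<open>With all initial weights 1 the final potential is at most \<open>card N\<close>, which
  bounds each single summand. Taking logarithms gives one additive error common to all test
  functions.\<close>

lemma greedy_pairs_log:
  fixes y :: "'u \<Rightarrow> 'a \<Rightarrow> 'a \<Rightarrow> real"
  assumes N: "finite N"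
    and y0: "\<And>u a c. u \<in> N \<Longrightarrow> 0 \<le> y u a c" and y4: "\<And>u a c. u \<in> N \<Longrightarrow> y u a c \<le> 4"
    and ydiag: "\<And>u a. y u a a = 0" "\<And>u a. y u a (p a) = 0"
    and R: "finite R" "R \<noteq> {}" "p ` R \<subseteq> R" "\<And>a. a \<in> R \<Longrightarrow> p (p a) = a"
  shows "\<exists>Q. Q \<subseteq> R \<times> R \<and> disjoint_family_on (quad p) Q \<and> (\<forall>(a, c)\<in>Q. c \<noteq> a \<and> c \<noteq> p a) \<and>
    (\<forall>u\<in>N. (\<Sum>a\<in>R. \<Sum>c\<in>R. y u a c) / real (card R)
       \<le> 16 * (\<Sum>(a, c)\<in>Q. y u a c) + 160 * ln (real (card N)))"
proof -
  have v: "real (card R) > 0" using R(1,2) by (simp add: card_gt_0_iff)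
  obtain Q where Q: "Q \<subseteq> R \<times> R" "disjoint_family_on (quad p) Q" "\<forall>(a, c)\<in>Q. c \<noteq> a \<and> c \<noteq> p a"
    and le: "(\<Sum>u\<in>N. 1 * exp (((\<Sum>a\<in>R. \<Sum>c\<in>R. y u a c) / real (card R)
        - 16 * (\<Sum>(a, c)\<in>Q. y u a c)) / 160)) \<le> (\<Sum>u\<in>N. 1)"
    using greedy_pairs[where p = p and y = y and w = "\<lambda>_. 1" and v = "real (card R)",
        OF N y0 y4 ydiag v R(1,3,4)] by auto
  show ?thesis
  proof (intro exI[of _ Q] conjI Q ballI)
    fix u assume u: "u \<in> N"
    let ?x = "((\<Sum>a\<in>R. \<Sum>c\<in>R. y u a c) / real (card R) - 16 * (\<Sum>(a, c)\<in>Q. y u a c)) / 160"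
    have "exp ?x \<le> (\<Sum>u\<in>N. exp (((\<Sum>a\<in>R. \<Sum>c\<in>R. y u a c) / real (card R)
        - 16 * (\<Sum>(a, c)\<in>Q. y u a c)) / 160))"
      using N u by (intro member_le_sum) auto
    also have "\<dots> \<le> real (card N)" using le by simp
    finally have "?x \<le> ln (real (card N))"
      using ln_mono[of "exp ?x" "real (card N)"] by simp
    then show "(\<Sum>a\<in>R. \<Sum>c\<in>R. y u a c) / real (card R)
       \<le> 16 * (\<Sum>(a, c)\<in>Q. y u a c) + 160 * ln (real (card N))" by simp
  qed
qed

section \<open>Few fractional coefficients and zonotopes\<close>

text \<open>Gaussian elimination, one coordinate per induction step: a vector with nonzero entry at
  \<open>i0\<close> serves as pivot. \<open>J\<close> may be infinite, as only the number of
  coordinates matters.\<close>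

lemma spanning_subfamily:
  fixes phi :: "'j \<Rightarrow> 'i \<Rightarrow> real"
  assumes "finite I"
  shows "\<exists>B\<subseteq>J. finite B \<and> card B \<le> card I \<and>
    (\<forall>j\<in>J. \<exists>\<beta>. \<forall>i\<in>I. phi j i = (\<Sum>l\<in>B. \<beta> l * phi l i))"
  using assms
proof (induction I arbitrary: phi)
  case empty
  then show ?case by (intro exI[of _ "{}"]) auto
next
  case (insert i0 I)
  show ?case
  proof (cases "\<forall>j\<in>J. phi j i0 = 0")
    case True
    obtain B where B: "B \<subseteq> J" "finite B" "card B \<le> card I"
      "\<forall>j\<in>J. \<exists>\<beta>. \<forall>i\<in>I. phi j i = (\<Sum>l\<in>B. \<beta> l * phi l i)"
      using insert.IH[of phi] by blast
    have "(\<Sum>l\<in>B. \<beta> l * phi l i0) = 0" for \<beta>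
      using True B(1) by (intro sum.neutral) auto
    then show ?thesis using B True insert.hyps
      by (intro exI[of _ B]) auto
  next
    case False
    then obtain j0 where j0: "j0 \<in> J" "phi j0 i0 \<noteq> 0" by blast
    define c where "c = phi j0 i0"
    define phi' where "phi' = (\<lambda>j i. phi j i - phi j i0 / c * phi j0 i)"
    obtain B where B: "B \<subseteq> J" "finite B" "card B \<le> card I"
      "\<forall>j\<in>J. \<exists>\<beta>. \<forall>i\<in>I. phi' j i = (\<Sum>l\<in>B. \<beta> l * phi' l i)"
      using insert.IH[of phi'] by blast
    define B' where "B' = B - {j0}"
    have B': "B' \<subseteq> J" "finite B'" "card B' \<le> card I" "j0 \<notin> B'"
      using B card_mono[of B B'] by (auto simp: B'_def)
    have zero: "phi' j0 i = 0" "phi' j i0 = 0" for i j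
      using j0 by (auto simp: phi'_def c_def)
    have "\<exists>\<beta>. \<forall>i\<in>insert i0 I. phi j i = (\<Sum>l\<in>insert j0 B'. \<beta> l * phi l i)" if j: "j \<in> J" for j
    proof -
      obtain \<beta> where \<beta>: "\<And>i. i \<in> I \<Longrightarrow> phi' j i = (\<Sum>l\<in>B. \<beta> l * phi' l i)"
        using B(4) j by blast
      have B'sum: "phi' j i = (\<Sum>l\<in>B'. \<beta> l * phi' l i)" if "i \<in> insert i0 I" for i
      proof (cases "i = i0")
        case True
        then show ?thesis by (simp add: zero)
      next
        case False
        have "(\<Sum>l\<in>B. \<beta> l * phi' l i) = (\<Sum>l\<in>B'. \<beta> l * phi' l i)"
          unfolding B'_def using B(2) by (intro sum.mono_neutral_right) (auto simp: zero)
        then show ?thesis using \<beta> that False by simp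
      qed
      define \<gamma> where "\<gamma> = \<beta>(j0 := (phi j i0 - (\<Sum>l\<in>B'. \<beta> l * phi l i0)) / c)"
      have "phi j i = (\<Sum>l\<in>insert j0 B'. \<gamma> l * phi l i)" if i: "i \<in> insert i0 I" for i
      proof -
        have "(\<Sum>l\<in>B'. \<gamma> l * phi l i) = (\<Sum>l\<in>B'. \<beta> l * phi l i)"
          using B'(4) by (intro sum.cong) (auto simp: \<gamma>_def)
        moreover have "(\<Sum>l\<in>B'. \<beta> l * phi' l i)
          = (\<Sum>l\<in>B'. \<beta> l * phi l i) - (\<Sum>l\<in>B'. \<beta> l * phi l i0) / c * phi j0 i"
          unfolding phi'_def
          by (simp add: algebra_simps sum_subtractf sum_divide_distrib sum_distrib_left)
        ultimately show ?thesis using B'sum[OF i] B'(2,4)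
          by (simp add: \<gamma>_def phi'_def diff_divide_distrib algebra_simps)
      qed
      then show ?thesis by blast
    qed
    then show ?thesis using B' j0 insert.hyps
      by (intro exI[of _ "insert j0 B'"]) auto
  qed
qed

text \<open>A member outside a spanning subfamily is a combination of it; taken with coefficient -1,
  it gives a nontrivial relation.\<close>

lemma linear_dependency:
  fixes phi :: "'j \<Rightarrow> 'i \<Rightarrow> real"
  assumes "finite I" "finite J" "card I < card J"
  obtains \<alpha> where "\<exists>j\<in>J. \<alpha> j \<noteq> 0" "\<And>i. i \<in> I \<Longrightarrow> (\<Sum>j\<in>J. \<alpha> j * phi j i) = 0"
proof -
  obtain B where B: "B \<subseteq> J" "finite B" "card B \<le> card I"
    "\<forall>j\<in>J. \<exists>\<beta>. \<forall>i\<in>I. phi j i = (\<Sum>l\<in>B. \<beta> l * phi l i)"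
    using spanning_subfamily[OF assms(1), of J phi] by blast
  have "B \<noteq> J" using B(3) assms(3) by auto
  then obtain j where j: "j \<in> J" "j \<notin> B" using B(1) by blast
  obtain \<beta> where \<beta>: "\<And>i. i \<in> I \<Longrightarrow> phi j i = (\<Sum>l\<in>B. \<beta> l * phi l i)"
    using B(4) j by blast
  define \<alpha> where "\<alpha> = (\<lambda>l. if l \<in> B then \<beta> l else if l = j then -1 else 0)"
  show thesis
  proof (rule that[of \<alpha>])
    show "\<exists>j\<in>J. \<alpha> j \<noteq> 0" using j by (intro bexI[of _ j]) (auto simp: \<alpha>_def)
    fix i assume i: "i \<in> I"
    have "(\<Sum>l\<in>J. \<alpha> l * phi l i) = (\<Sum>l\<in>insert j B. \<alpha> l * phi l i)"
      using assms(2) B(1) j by (intro sum.mono_neutral_right) (auto simp: \<alpha>_def)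
    also have "\<dots> = - phi j i + (\<Sum>l\<in>B. \<alpha> l * phi l i)"
      using B(2) j by (simp add: \<alpha>_def)
    also have "(\<Sum>l\<in>B. \<alpha> l * phi l i) = (\<Sum>l\<in>B. \<beta> l * phi l i)"
      by (intro sum.cong) (auto simp: \<alpha>_def)
    finally show "(\<Sum>l\<in>J. \<alpha> l * phi l i) = 0" using \<beta>[OF i] by simp
  qed
qed

text \<open>With more than \<open>card I\<close> fractional coefficients the corresponding vectors
  are dependent. Moving along the dependency preserves the sum until a coefficient reaches 0 or 1
  and ceases to be fractional.\<close>

lemma few_fractional_coefficients:
  fixes phi :: "'j \<Rightarrow> 'i \<Rightarrow> real"
  assumes I: "finite I" and J: "finite J"
  shows "(\<And>j. j \<in> J \<Longrightarrow> 0 \<le> l j \<and> l j \<le> (1::real)) \<Longrightarrow>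
    \<exists>m. (\<forall>j\<in>J. 0 \<le> m j \<and> m j \<le> 1) \<and> card {j\<in>J. 0 < m j \<and> m j < 1} \<le> card I \<and>
      (\<forall>i\<in>I. (\<Sum>j\<in>J. m j * phi j i) = (\<Sum>j\<in>J. l j * phi j i))"
proof (induction "card {j\<in>J. 0 < l j \<and> l j < 1}" arbitrary: l rule: less_induct)
  case less
  define Fr where "Fr = {j\<in>J. 0 < l j \<and> l j < 1}"
  show ?case
  proof (cases "card Fr \<le> card I")
    case True
    then show ?thesis using less.prems by (intro exI[of _ l]) (auto simp: Fr_def)
  next
    case False
    have finFr: "finite Fr" using J by (auto simp: Fr_def)
    obtain \<alpha> where \<alpha>: "\<exists>j\<in>Fr. \<alpha> j \<noteq> 0" "\<And>i. i \<in> I \<Longrightarrow> (\<Sum>j\<in>Fr. \<alpha> j * phi j i) = 0"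
      using linear_dependency[OF I finFr, of phi] False by auto
    define K where "K = {j\<in>Fr. \<alpha> j \<noteq> 0}"
    have K: "finite K" "K \<noteq> {}" using finFr \<alpha>(1) by (auto simp: K_def)
    \<comment> \<open>The time at which coefficient \<open>j\<close> reaches 1 or 0, depending on
      the sign of \<open>\<alpha> j\<close>; the minimum \<open>s\<close> is the first such
      event.\<close>
    define h where "h = (\<lambda>j. if \<alpha> j > 0 then (1 - l j) / \<alpha> j else l j / (- \<alpha> j))"
    define s where "s = Min (h ` K)"
    have sle: "s \<le> h j" if "j \<in> K" for j unfolding s_def using K that by simp
    obtain j0 where j0: "j0 \<in> K" "s = h j0"
    proof -
      have "s \<in> h ` K" unfolding s_def using K by (intro Min_in) auto
      then show thesis using that by blast
    qed
    have hpos: "h j > 0" if "j \<in> K" for j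
    proof (cases "\<alpha> j > 0")
      case True
      then show ?thesis using that by (simp add: h_def K_def Fr_def)
    next
      case False
      then have "- \<alpha> j > 0" "l j > 0" using that by (simp_all add: K_def Fr_def)
      then show ?thesis using False unfolding h_def by (simp only: if_False) (rule divide_pos_pos)
    qed
    then have s0: "s > 0" using j0 by auto
    define l' where "l' = (\<lambda>j. if j \<in> Fr then l j + s * \<alpha> j else l j)"
    have l'01: "0 \<le> l' j \<and> l' j \<le> 1" if j: "j \<in> J" for j
    proof (cases "j \<in> K")
      case True
      then have F: "j \<in> Fr" "0 < l j" "l j < 1" "\<alpha> j \<noteq> 0" by (auto simp: K_def Fr_def)
      show ?thesis
      proof (cases "\<alpha> j > 0")
        case True
        then have "s * \<alpha> j \<le> 1 - l j" using sle[OF \<open>j \<in> K\<close>] by (simp add: h_def pos_le_divide_eq)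
        moreover have "s * \<alpha> j > 0" using True s0 by simp
        ultimately show ?thesis using F by (simp add: l'_def)
      next
        case False
        then have "s * (- \<alpha> j) \<le> l j" using sle[OF \<open>j \<in> K\<close>] F
          by (simp add: h_def pos_le_divide_eq flip: divide_minus_right)
        moreover have "s * \<alpha> j < 0" using False F s0 by (simp add: mult_pos_neg)
        ultimately show ?thesis using F by (simp add: l'_def)
      qed
    next
      case False
      then show ?thesis using less.prems[OF j] by (auto simp: l'_def K_def)
    qed
    have "l' j0 = 0 \<or> l' j0 = 1"
      using j0 by (auto simp: l'_def h_def K_def)
    then have "{j\<in>J. 0 < l' j \<and> l' j < 1} \<subset> Fr"
      using j0 by (force simp: Fr_def K_def l'_def)
    then have lt: "card {j\<in>J. 0 < l' j \<and> l' j < 1} < card Fr"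
      using finFr by (rule psubset_card_mono[rotated])
    have same: "(\<Sum>j\<in>J. l' j * phi j i) = (\<Sum>j\<in>J. l j * phi j i)" if i: "i \<in> I" for i
    proof -
      have "(\<Sum>j\<in>J. l' j * phi j i) = (\<Sum>j\<in>J. l j * phi j i + (if j \<in> Fr then s * (\<alpha> j * phi j i) else 0))"
        by (intro sum.cong) (auto simp: l'_def algebra_simps)
      also have "\<dots> = (\<Sum>j\<in>J. l j * phi j i) + (\<Sum>j\<in>Fr. s * (\<alpha> j * phi j i))"
        using J by (simp add: sum.distrib sum.If_cases Fr_def Int_def cong: conj_cong)
      also have "\<dots> = (\<Sum>j\<in>J. l j * phi j i)"
        using \<alpha>(2)[OF i] by (simp flip: sum_distrib_left)
      finally show ?thesis .
    qed
    obtain m where "(\<forall>j\<in>J. 0 \<le> m j \<and> m j \<le> 1) \<and> card {j\<in>J. 0 < m j \<and> m j < 1} \<le> card I \<and>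
      (\<forall>i\<in>I. (\<Sum>j\<in>J. m j * phi j i) = (\<Sum>j\<in>J. l' j * phi j i))"
      using less.hyps[OF lt[unfolded Fr_def] l'01] by (rule exE)
    then show ?thesis using same by auto
  qed
qed

text \<open>The at most \<open>card I\<close> coefficients that remain fractional are set to 0, and
  each costs at most \<open>c\<close> in the 1-norm.\<close>

lemma round_coefficients:
  fixes phi :: "'j \<Rightarrow> 'i \<Rightarrow> real"
  assumes I: "finite I" and J: "finite J"
    and l: "\<And>j. j \<in> J \<Longrightarrow> 0 \<le> l j \<and> l j \<le> (1::real)"
    and c: "\<And>j. j \<in> J \<Longrightarrow> (\<Sum>i\<in>I. \<bar>phi j i\<bar>) \<le> c" "c \<ge> 0"
  obtains J' where "J' \<subseteq> J"
    "(\<Sum>i\<in>I. \<bar>(\<Sum>j\<in>J'. phi j i) - (\<Sum>j\<in>J. l j * phi j i)\<bar>) \<le> c * real (card I)"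
proof -
  obtain m where "(\<forall>j\<in>J. 0 \<le> m j \<and> m j \<le> 1) \<and> card {j\<in>J. 0 < m j \<and> m j < 1} \<le> card I \<and>
      (\<forall>i\<in>I. (\<Sum>j\<in>J. m j * phi j i) = (\<Sum>j\<in>J. l j * phi j i))"
    using few_fractional_coefficients[OF I J l, where phi = phi] by (rule exE)
  then have m: "\<And>j. j \<in> J \<Longrightarrow> 0 \<le> m j \<and> m j \<le> 1"
    "card {j\<in>J. 0 < m j \<and> m j < 1} \<le> card I"
    "\<And>i. i \<in> I \<Longrightarrow> (\<Sum>j\<in>J. m j * phi j i) = (\<Sum>j\<in>J. l j * phi j i)"
    by simp_all
  define Fr where "Fr = {j\<in>J. 0 < m j \<and> m j < 1}"
  define J' where "J' = {j\<in>J. m j = 1}"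
  have sub: "J' \<union> Fr \<subseteq> J" "J' \<inter> Fr = {}" by (auto simp: J'_def Fr_def)
  have fin: "finite J'" "finite Fr" using J by (auto simp: J'_def Fr_def)
  have diff: "(\<Sum>j\<in>J'. phi j i) - (\<Sum>j\<in>J. l j * phi j i) = - (\<Sum>j\<in>Fr. m j * phi j i)" if "i \<in> I" for i
  proof -
    have "(\<Sum>j\<in>J. m j * phi j i) = (\<Sum>j\<in>J' \<union> Fr. m j * phi j i)"
      using J m(1) by (intro sum.mono_neutral_right) (force simp: J'_def Fr_def)+
    also have "\<dots> = (\<Sum>j\<in>J'. m j * phi j i) + (\<Sum>j\<in>Fr. m j * phi j i)"
      using fin sub by (intro sum.union_disjoint) auto
    also have "(\<Sum>j\<in>J'. m j * phi j i) = (\<Sum>j\<in>J'. phi j i)"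
      by (intro sum.cong) (auto simp: J'_def)
    finally show ?thesis using m(3)[OF that] by simp
  qed
  have "(\<Sum>i\<in>I. \<bar>(\<Sum>j\<in>J'. phi j i) - (\<Sum>j\<in>J. l j * phi j i)\<bar>) = (\<Sum>i\<in>I. \<bar>\<Sum>j\<in>Fr. m j * phi j i\<bar>)"
    using diff by (intro sum.cong) auto
  also have "\<dots> \<le> (\<Sum>i\<in>I. \<Sum>j\<in>Fr. \<bar>phi j i\<bar>)"
  proof (intro sum_mono order.trans[OF sum_abs])
    fix i j assume "j \<in> Fr"
    then show "\<bar>m j * phi j i\<bar> \<le> \<bar>phi j i\<bar>"
      by (auto simp: Fr_def abs_mult intro!: mult_left_le_one_le)
  qed
  also have "\<dots> = (\<Sum>j\<in>Fr. \<Sum>i\<in>I. \<bar>phi j i\<bar>)" by (rule sum.swap)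
  also have "\<dots> \<le> real (card Fr) * c" using c(1) by (intro sum_bounded_above) (auto simp: Fr_def)
  also have "\<dots> \<le> c * real (card I)" using m(2) c(2) by (simp add: Fr_def mult.commute mult_left_mono)
  finally show thesis using that[of J'] by (auto simp: J'_def)
qed

text \<open>Minimise the Euclidean distance from \<open>w\<close> to the zonotope. At a minimiser
  the nearest point attains the support function in the direction of the residual \<open>u\<close>;
  then \<open>sup\<close>, tested on the normalised residual, bounds its length by
  \<open>E\<close>.\<close>

lemma zonotope_approximation:
  fixes phi :: "'j \<Rightarrow> 'i \<Rightarrow> real"
  assumes I: "finite I" and J: "finite J"
    and sup: "\<And>u. (\<And>i. \<bar>u i\<bar> \<le> 1) \<Longrightarrow>
      (\<Sum>i\<in>I. u i * w i) \<le> (\<Sum>j\<in>J. max 0 (\<Sum>i\<in>I. u i * phi j i)) + E"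
  obtains l where "\<And>j. j \<in> J \<Longrightarrow> 0 \<le> l j \<and> l j \<le> (1::real)"
    "(\<Sum>i\<in>I. (w i - (\<Sum>j\<in>J. l j * phi j i))\<^sup>2) \<le> E\<^sup>2"
proof -
  define g where "g = (\<lambda>l. \<Sum>i\<in>I. (w i - (\<Sum>j\<in>J. l j * phi j i))\<^sup>2)"
  define P where "P = (PiE J (\<lambda>_. {0..1::real}))"
  have "compactin (product_topology (\<lambda>_. euclideanreal) J) P"
    unfolding P_def compactin_PiE by simp
  have coord: "continuous_map (product_topology (\<lambda>_. euclideanreal) J) euclideanreal (\<lambda>l. l j)"
    if "j \<in> J" for j using that by (rule continuous_map_product_projection)
  have "continuous_map (product_topology (\<lambda>_. euclideanreal) J) euclideanreal g"
    unfolding g_def using I J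
    by (intro continuous_map_sum continuous_map_real_pow continuous_map_diff
        continuous_map_real_mult coord) auto
  then have "compactin euclideanreal (g ` P)"
    using \<open>compactin _ P\<close> image_compactin by blast
  moreover have "g ` P \<noteq> {}" unfolding P_def by (auto simp: PiE_eq_empty_iff)
  ultimately obtain l where l: "l \<in> P" and lmin: "\<And>l'. l' \<in> P \<Longrightarrow> g l \<le> g l'"
    using compact_attains_inf[of "g ` P"] by auto
  have l01: "0 \<le> l j \<and> l j \<le> 1" if "j \<in> J" for j using l that unfolding P_def by auto
  define u where "u = (\<lambda>i. w i - (\<Sum>j\<in>J. l j * phi j i))"
  define ip where "ip = (\<lambda>j. \<Sum>i\<in>I. u i * phi j i)"
  define nn where "nn = (\<lambda>j. \<Sum>i\<in>I. (phi j i)\<^sup>2)"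
  have move: "2 * s * ip j \<le> s\<^sup>2 * nn j" if j: "j \<in> J" and s: "0 \<le> l j + s" "l j + s \<le> 1" for j s
  proof -
    have "l(j := l j + s) \<in> P" using l j s unfolding P_def by (auto simp: PiE_iff extensional_def)
    then have "g l \<le> g (l(j := l j + s))" by (rule lmin)
    also have "g (l(j := l j + s)) = (\<Sum>i\<in>I. (u i - s * phi j i)\<^sup>2)"
    proof -
      have "(\<Sum>j'\<in>J. (l(j := l j + s)) j' * phi j' i) = (\<Sum>j\<in>J. l j * phi j i) + s * phi j i" for i
        using J j by (simp add: sum.remove algebra_simps)
      then show ?thesis unfolding g_def u_def by (simp add: algebra_simps)
    qed
    also have "\<dots> = (\<Sum>i\<in>I. (u i)\<^sup>2) - 2 * s * ip j + s\<^sup>2 * nn j"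
      unfolding ip_def nn_def
      by (simp add: power2_diff sum.distrib sum_subtractf sum_distrib_left power_mult_distrib mult_ac)
    also have "g l = (\<Sum>i\<in>I. (u i)\<^sup>2)" by (simp add: g_def u_def)
    finally show ?thesis by linarith
  qed
  \<comment> \<open>First-order optimality: a bound of order \<open>s\<^sup>2\<close> on a term
    linear in \<open>s\<close> forces a nonpositive slope.\<close>
  have small: "x \<le> 0" if "t > 0" "\<And>s. 0 < s \<Longrightarrow> s \<le> t \<Longrightarrow> 2 * s * x \<le> s\<^sup>2 * n" "n \<ge> 0" for x t n :: real
  proof (rule ccontr)
    assume "\<not> x \<le> 0"
    define s where "s = min t (x / (n + 1))"
    have s: "0 < s" "s \<le> t" "s \<le> x / (n + 1)" using that \<open>\<not> x \<le> 0\<close> by (auto simp: s_def)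
    have "s * (2 * x) \<le> s * (s * n)" using that(2)[OF s(1,2)] by (simp add: power2_eq_square mult_ac)
    then have "2 * x \<le> s * n" using s(1) by simp
    also have "\<dots> \<le> s * (n + 1)" using s(1) by simp
    also have "\<dots> \<le> x" using s(3) that(3) by (simp add: pos_le_divide_eq)
    finally show False using \<open>\<not> x \<le> 0\<close> by simp
  qed
  have nn0: "nn j \<ge> 0" for j unfolding nn_def by (intro sum_nonneg) simp
  \<comment> \<open>Complementary slackness: \<open>l j < 1\<close> forces \<open>ip j\<close> to be
    nonpositive, and \<open>l j > 0\<close> forces it to be nonnegative.\<close>
  have compl: "l j * ip j = max 0 (ip j)" if j: "j \<in> J" for j
  proof -
    have "ip j \<le> 0" if "l j < 1"
      using that l01[OF j] nn0 by (intro small[of "1 - l j" "ip j" "nn j"] move[OF j]) auto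
    moreover have "- ip j \<le> 0" if "l j > 0"
    proof (intro small[of "l j" "- ip j" "nn j"])
      fix s :: real assume "0 < s" "s \<le> l j"
      then show "2 * s * - ip j \<le> s\<^sup>2 * nn j" using move[OF j, of "- s"] l01[OF j] by simp
    qed (use that nn0 in auto)
    ultimately show ?thesis using l01[OF j]
      by (cases "l j = 0"; cases "l j = 1") (auto simp: max_def)
  qed
  define \<rho> where "\<rho> = sqrt (\<Sum>i\<in>I. (u i)\<^sup>2)"
  have rho2: "\<rho>\<^sup>2 = (\<Sum>i\<in>I. (u i)\<^sup>2)" unfolding \<rho>_def by (simp add: sum_nonneg)
  have E0: "E \<ge> 0" using sup[of "\<lambda>_. 0"] by simp
  have "\<rho> \<le> E"
  proof (cases "\<rho> = 0")
    case True
    then show ?thesis using E0 by simp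
  next
    case False
    then have pos: "\<rho> > 0" using \<rho>_def by (simp add: sum_nonneg less_le)
    \<comment> \<open>A Euclidean unit vector, hence admissible for \<open>sup\<close>; it is 0
      outside \<open>I\<close> because \<open>sup\<close> asks for the bound at every index.\<close>
    define u' where "u' = (\<lambda>i. if i \<in> I then u i / \<rho> else 0)"
    have "\<bar>u' i\<bar> \<le> 1" for i
    proof (cases "i \<in> I")
      case True
      have "(u i)\<^sup>2 \<le> \<rho>\<^sup>2" unfolding rho2 using I True by (intro member_le_sum) auto
      then have "\<bar>u i\<bar> \<le> \<rho>" using pos by (metis abs_le_square_iff abs_of_pos)
      then show ?thesis using True pos by (simp add: u'_def)
    qed (simp add: u'_def)
    then have "(\<Sum>i\<in>I. u' i * w i) \<le> (\<Sum>j\<in>J. max 0 (\<Sum>i\<in>I. u' i * phi j i)) + E" by (rule sup)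
    moreover have "(\<Sum>i\<in>I. u' i * w i) = (\<Sum>i\<in>I. u i * w i) / \<rho>"
      by (simp add: u'_def sum_divide_distrib)
    moreover have "(\<Sum>i\<in>I. u' i * phi j i) = ip j / \<rho>" for j
      by (simp add: u'_def ip_def sum_divide_distrib)
    moreover have "max 0 (ip j / \<rho>) = max 0 (ip j) / \<rho>" for j
      using pos by (simp add: max_def zero_le_divide_iff)
    ultimately have "(\<Sum>i\<in>I. u i * w i) / \<rho> \<le> (\<Sum>j\<in>J. max 0 (ip j)) / \<rho> + E"
      by (simp add: sum_divide_distrib)
    moreover have "(\<Sum>j\<in>J. max 0 (ip j)) = (\<Sum>i\<in>I. u i * w i) - \<rho>\<^sup>2"
    proof -
      have "(\<Sum>j\<in>J. max 0 (ip j)) = (\<Sum>j\<in>J. l j * ip j)" by (simp add: compl)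
      also have "\<dots> = (\<Sum>j\<in>J. \<Sum>i\<in>I. u i * (l j * phi j i))"
        by (simp add: ip_def sum_distrib_left mult_ac)
      also have "\<dots> = (\<Sum>i\<in>I. u i * (\<Sum>j\<in>J. l j * phi j i))"
        by (subst sum.swap) (simp add: sum_distrib_left)
      also have "\<dots> = (\<Sum>i\<in>I. u i * (w i - u i))" by (simp add: u_def)
      also have "\<dots> = (\<Sum>i\<in>I. u i * w i) - \<rho>\<^sup>2"
        unfolding rho2 by (simp add: right_diff_distrib sum_subtractf power2_eq_square)
      finally show ?thesis .
    qed
    ultimately have "\<rho>\<^sup>2 / \<rho> \<le> E" by (simp add: diff_divide_distrib)
    then show ?thesis using pos by (simp add: power2_eq_square)
  qed
  moreover have "\<rho> \<ge> 0" by (simp add: \<rho>_def sum_nonneg)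
  ultimately have "\<rho>\<^sup>2 \<le> E\<^sup>2" by (intro power_mono)
  then show thesis using that[of l] l01 rho2 by (simp add: u_def)
qed

section \<open>Piecewise linear functions on the cube\<close>

text \<open>
  Moving along a line inside the cell of a point keeps all terms linear, so the first wall that is
  hit in a direction of non-increase yields a point with more tight equations.
\<close>

lemma piecewise_linear_descent:
  fixes g :: "'i \<Rightarrow> real" and L :: "(('i \<Rightarrow> real) \<times> real) set"
  assumes I: "finite I" and L: "finite L" and J: "finite J"
    and cube: "\<And>i. i \<in> I \<Longrightarrow> (indicator {i}, 1) \<in> L \<and> (indicator {i}, -1) \<in> L"
    and psi: "\<And>j. j \<in> J \<Longrightarrow> (psi j, 0) \<in> L"
  defines "ip \<equiv> \<lambda>a b. \<Sum>i\<in>I. a i * b i"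
  defines "F \<equiv> \<lambda>u. (\<Sum>j\<in>J. max 0 (ip (psi j) u)) + ip g u"
  defines "T \<equiv> \<lambda>u. {l\<in>L. ip (fst l) u = snd l}"
  assumes u: "\<And>i. i \<in> I \<Longrightarrow> \<bar>u i\<bar> \<le> 1"
    and x: "\<exists>i\<in>I. x i \<noteq> 0" "\<And>l. l \<in> T u \<Longrightarrow> ip (fst l) x = 0"
  obtains v where "\<And>i. i \<in> I \<Longrightarrow> \<bar>v i\<bar> \<le> 1" "F v \<le> F u" "T u \<subset> T v"
proof -
  have ip_add: "ip a (\<lambda>i. u i + s * b i) = ip a u + s * ip a b" for a b s
    unfolding ip_def by (simp add: algebra_simps sum.distrib sum_distrib_left)
  have ip_neg: "ip a (\<lambda>i. - b i) = - ip a b" for a b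
    unfolding ip_def by (simp add: sum_negf)
  have ip_ind: "ip (indicator {i}) b = b i" if "i \<in> I" for i b
    unfolding ip_def using I that by (simp add: indicator_def sum.If_cases)
  \<comment> \<open>The slope of \<open>F\<close> at \<open>u\<close> along directions that keep
    tight walls tight: positive terms move linearly, while terms that are negative or zero at
    \<open>u\<close> contribute nothing.\<close>
  define slope where "slope = (\<lambda>b. (\<Sum>j\<in>J. if ip (psi j) u > 0 then ip (psi j) b else 0) + ip g b)"
  have slope_neg: "slope (\<lambda>i. - b i) = - slope b" for b
    unfolding slope_def ip_neg by (simp add: sum_negf[symmetric] if_distrib cong: if_cong)
  obtain z where z: "\<exists>i\<in>I. z i \<noteq> 0" "\<And>l. l \<in> T u \<Longrightarrow> ip (fst l) z = 0" "slope z \<le> 0"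
  proof (cases "slope x \<le> 0")
    case True
    then show ?thesis using that x by blast
  next
    case False
    then show ?thesis using that[of "\<lambda>i. - x i"] x slope_neg[of x] ip_neg by auto
  qed
  define hit where "hit = (\<lambda>l. (snd l - ip (fst l) u) / ip (fst l) z)"
  define K where "K = {l \<in> L. ip (fst l) z \<noteq> 0 \<and> hit l > 0}"
  obtain i where i: "i \<in> I" "z i \<noteq> 0" using z(1) by blast
  \<comment> \<open>A facet of the cube lies ahead whenever \<open>z i\<close> is nonzero, so the
    motion does hit a wall.\<close>
  have "(indicator {i}, sgn (z i)) \<in> K"
  proof -
    have in_L: "(indicator {i}, sgn (z i)) \<in> L" using cube[OF i(1)] i(2) by (auto simp: sgn_if)
    have "u i \<noteq> sgn (z i)"
      using z(2)[of "(indicator {i}, sgn (z i))"] in_L i by (auto simp: T_def ip_ind)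
    then have "(sgn (z i) - u i) / z i > 0"
      using u[OF i(1)] i(2) by (auto simp: sgn_if zero_less_divide_iff split: if_splits)
    then show ?thesis using in_L i by (simp add: K_def hit_def ip_ind)
  qed
  then have K: "finite K" "K \<noteq> {}" using L by (auto simp: K_def)
  define s where "s = Min (hit ` K)"
  have "s \<in> hit ` K" unfolding s_def using K by (intro Min_in) auto
  then obtain l0 where l0: "l0 \<in> K" "s = hit l0" by blast
  have s0: "s > 0" using l0 by (simp add: K_def)
  have sle: "s \<le> hit l" if "l \<in> K" for l unfolding s_def using K that by simp
  define v where "v = (\<lambda>i. u i + s * z i)"
  have ipv: "ip a v = ip a u + s * ip a z" for a unfolding v_def by (rule ip_add)
  \<comment> \<open>No wall is crossed before the first hit time \<open>s\<close>: a point on a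
    closed side of a wall stays there.\<close>
  have below: "ip (fst l) v \<le> snd l" if l: "l \<in> L" "ip (fst l) u \<le> snd l" for l
  proof (cases "ip (fst l) u = snd l")
    case True
    then show ?thesis using z(2)[of l] l by (simp add: T_def ipv)
  next
    case False
    show ?thesis
    proof (cases "ip (fst l) z > 0")
      case True
      then have "l \<in> K" using False l by (simp add: K_def hit_def)
      then show ?thesis using sle[of l] True by (simp add: hit_def ipv pos_le_divide_eq)
    next
      case False
      then have "s * ip (fst l) z \<le> 0" using s0 by (simp add: mult_nonneg_nonpos)
      then show ?thesis using l by (simp add: ipv)
    qed
  qed
  have above: "ip (fst l) v \<ge> snd l" if l: "l \<in> L" "ip (fst l) u \<ge> snd l" for l
  proof (cases "ip (fst l) u = snd l")
    case True
    then show ?thesis using z(2)[of l] l by (simp add: T_def ipv)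
  next
    case False
    show ?thesis
    proof (cases "ip (fst l) z < 0")
      case True
      then have "l \<in> K" using False l by (simp add: K_def hit_def divide_neg_neg)
      then show ?thesis using sle[of l] True by (simp add: hit_def ipv neg_le_divide_eq)
    next
      case False
      then have "s * ip (fst l) z \<ge> 0" using s0 by simp
      then show ?thesis using l by (simp add: ipv)
    qed
  qed
  show thesis
  proof (rule that[of v])
    fix i assume i: "i \<in> I"
    show "\<bar>v i\<bar> \<le> 1"
      using below[of "(indicator {i}, 1)"] above[of "(indicator {i}, -1)"] cube[OF i] u[OF i]
      by (simp add: ip_ind i abs_le_iff)
  next
    have "max 0 (ip (psi j) v)
      = max 0 (ip (psi j) u) + s * (if ip (psi j) u > 0 then ip (psi j) z else 0)" if j: "j \<in> J" for j
      using below[OF psi[OF j]] above[OF psi[OF j]] ipv[of "psi j"]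
      by (cases "ip (psi j) u > 0") (auto simp: max_def)
    then have "F v = F u + s * slope z"
      unfolding F_def slope_def
      by (simp add: sum.distrib ipv[of g] distrib_left sum_distrib_left del: max.bounded_iff)
    then show "F v \<le> F u" using s0 z(3) by (simp add: mult_nonneg_nonpos)
  next
    have "T u \<subseteq> T v" using z(2) by (auto simp: T_def ipv)
    moreover have "l0 \<in> T v" "l0 \<notin> T u"
      using l0 s0 by (auto simp: T_def ipv K_def hit_def)
    ultimately show "T u \<subset> T v" by blast
  qed
qed

text \<open>Each descent step enlarges the set of tight walls, so the process ends at a point of the
  cube that its tight walls determine, that is, a vertex of the arrangement.\<close>

lemma piecewise_linear_vertex:
  fixes g :: "'i \<Rightarrow> real" and L :: "(('i \<Rightarrow> real) \<times> real) set"
  assumes I: "finite I" and L: "finite L" and J: "finite J"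
    and cube: "\<And>i. i \<in> I \<Longrightarrow> (indicator {i}, 1) \<in> L \<and> (indicator {i}, -1) \<in> L"
    and psi: "\<And>j. j \<in> J \<Longrightarrow> (psi j, 0) \<in> L"
  defines "ip \<equiv> \<lambda>a b. \<Sum>i\<in>I. a i * b i"
  defines "F \<equiv> \<lambda>u. (\<Sum>j\<in>J. max 0 (ip (psi j) u)) + ip g u"
  defines "T \<equiv> \<lambda>u. {l\<in>L. ip (fst l) u = snd l}"
  shows "(\<And>i. i \<in> I \<Longrightarrow> \<bar>u i\<bar> \<le> 1) \<Longrightarrow>
    \<exists>v. (\<forall>i\<in>I. \<bar>v i\<bar> \<le> 1) \<and> F v \<le> F u \<and>
      (\<forall>x. (\<forall>l\<in>T v. ip (fst l) x = 0) \<longrightarrow> (\<forall>i\<in>I. x i = 0))"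
proof (induction "card (L - T u)" arbitrary: u rule: less_induct)
  case less
  show ?case
  proof (cases "\<forall>x. (\<forall>l\<in>T u. ip (fst l) x = 0) \<longrightarrow> (\<forall>i\<in>I. x i = 0)")
    case True
    then show ?thesis using less.prems by (intro exI[of _ u]) auto
  next
    case False
    then obtain x where x: "\<exists>i\<in>I. x i \<noteq> 0" "\<And>l. l \<in> T u \<Longrightarrow> ip (fst l) x = 0" by blast
    obtain v where v: "\<And>i. i \<in> I \<Longrightarrow> \<bar>v i\<bar> \<le> 1" "F v \<le> F u" "T u \<subset> T v"
      using piecewise_linear_descent[where psi = psi and u = u and x = x and g = g,
          OF I L J cube psi less.prems x(1) x(2)[unfolded T_def ip_def]]
      unfolding T_def F_def ip_def by blast
    have "L - T v \<subset> L - T u" using v(3) unfolding T_def by blast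
    then have "card (L - T v) < card (L - T u)" using L by (intro psubset_card_mono) auto
    from less.hyps[OF this v(1)] obtain v' where "(\<forall>i\<in>I. \<bar>v' i\<bar> \<le> 1) \<and> F v' \<le> F v \<and>
      (\<forall>x. (\<forall>l\<in>T v'. ip (fst l) x = 0) \<longrightarrow> (\<forall>i\<in>I. x i = 0))" by (rule exE)
    then show ?thesis using v(2) by (intro exI[of _ v']) auto
  qed
qed

text \<open>A vertex is the only solution of at most \<open>card I\<close> tight equations, so lists
  of \<open>card I\<close> walls enumerate all vertices. One set \<open>N\<close> serves every
  \<open>J\<close>, \<open>psi\<close> and \<open>g\<close> compatible with \<open>L\<close>, so it
  can be fixed before the switches are chosen.\<close>

lemma finite_test_set:
  fixes L :: "(('i \<Rightarrow> real) \<times> real) set"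
  assumes I: "finite I" "I \<noteq> {}" and L: "finite L"
    and cube: "\<forall>i\<in>I. (indicator {i}, 1) \<in> L \<and> (indicator {i}, -1) \<in> L"
  obtains N :: "('i \<Rightarrow> real) set" where "finite N" "card N \<le> card L ^ card I"
    "\<And>v i. v \<in> N \<Longrightarrow> \<bar>v i\<bar> \<le> 1"
    "\<And>(J :: 'j set) psi g E u. \<lbrakk>finite J; \<And>j. j \<in> J \<Longrightarrow> (psi j, 0) \<in> L; \<And>i. \<bar>u i\<bar> \<le> 1;
      \<And>v. v \<in> N \<Longrightarrow> E \<le> (\<Sum>j\<in>J. max 0 (\<Sum>i\<in>I. psi j i * v i)) + (\<Sum>i\<in>I. g i * v i)\<rbrakk>
      \<Longrightarrow> E \<le> (\<Sum>j\<in>J. max 0 (\<Sum>i\<in>I. psi j i * u i)) + (\<Sum>i\<in>I. g i * u i)"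
proof -
  define ip where "ip = (\<lambda>a b :: 'i \<Rightarrow> real. \<Sum>i\<in>I. a i * b i)"
  \<comment> \<open>The value 0 outside \<open>I\<close> makes a vertex unique as a function. Lists
    without a unique solution yield arbitrary values, which do no harm: \<open>N\<close> keeps only
    points of the cube.\<close>
  define sol where "sol = (\<lambda>xs :: (('i \<Rightarrow> real) \<times> real) list.
    SOME v. (\<forall>i. i \<notin> I \<longrightarrow> v i = 0) \<and> (\<forall>l\<in>set xs. ip (fst l) v = snd l))"
  define X where "X = {xs. set xs \<subseteq> L \<and> length xs = card I}"
  define N where "N = sol ` X \<inter> {v. \<forall>i. \<bar>v i\<bar> \<le> 1}"
  have finX: "finite X" and cardX: "card X = card L ^ card I"
    unfolding X_def using L by (auto intro: finite_lists_length_eq simp: card_lists_length_eq)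
  show thesis
  proof (rule that[of N])
    show "finite N" using finX by (simp add: N_def)
    show "card N \<le> card L ^ card I"
      unfolding cardX[symmetric] N_def using finX
      by (meson card_image_le card_mono finite_imageI inf_le1 order.trans)
    show "\<And>v i. v \<in> N \<Longrightarrow> \<bar>v i\<bar> \<le> 1" by (simp add: N_def)
  next
    fix J :: "'j set" and psi g E and u :: "'i \<Rightarrow> real"
    assume J: "finite J" and psi: "\<And>j. j \<in> J \<Longrightarrow> (psi j, 0) \<in> L" and u: "\<And>i. \<bar>u i\<bar> \<le> 1"
      and N: "\<And>v. v \<in> N \<Longrightarrow> E \<le> (\<Sum>j\<in>J. max 0 (\<Sum>i\<in>I. psi j i * v i)) + (\<Sum>i\<in>I. g i * v i)"
    have "\<exists>v. (\<forall>i\<in>I. \<bar>v i\<bar> \<le> 1)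
      \<and> (\<Sum>j\<in>J. max 0 (ip (psi j) v)) + ip g v \<le> (\<Sum>j\<in>J. max 0 (ip (psi j) u)) + ip g u
      \<and> (\<forall>x. (\<forall>l\<in>{l\<in>L. ip (fst l) v = snd l}. ip (fst l) x = 0) \<longrightarrow> (\<forall>i\<in>I. x i = 0))"
      using piecewise_linear_vertex[where psi = psi and u = u and g = g, OF I(1) L J cube[rule_format] psi u]
      unfolding ip_def by blast
    then obtain v where v: "\<And>i. i \<in> I \<Longrightarrow> \<bar>v i\<bar> \<le> 1"
      "(\<Sum>j\<in>J. max 0 (ip (psi j) v)) + ip g v \<le> (\<Sum>j\<in>J. max 0 (ip (psi j) u)) + ip g u"
      "\<And>x i. \<lbrakk>\<And>l. l \<in> L \<Longrightarrow> ip (fst l) v = snd l \<Longrightarrow> ip (fst l) x = 0; i \<in> I\<rbrakk> \<Longrightarrow> x i = 0"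
      by blast
    define T where "T = {l\<in>L. ip (fst l) v = snd l}"
    obtain B where B: "B \<subseteq> T" "finite B" "card B \<le> card I"
      "\<forall>l\<in>T. \<exists>\<beta>. \<forall>i\<in>I. fst l i = (\<Sum>b\<in>B. \<beta> b * fst b i)"
      using spanning_subfamily[OF I(1), of T fst] by blast
    have uniq: "x i = 0" if x: "\<And>l. l \<in> B \<Longrightarrow> ip (fst l) x = 0" and i: "i \<in> I" for x i
    proof (rule v(3)[OF _ i])
      fix l assume "l \<in> L" "ip (fst l) v = snd l"
      then have "l \<in> T" by (simp add: T_def)
      then obtain \<beta> where "\<And>i. i \<in> I \<Longrightarrow> fst l i = (\<Sum>b\<in>B. \<beta> b * fst b i)"
        using B(4) by blast
      then have "ip (fst l) x = (\<Sum>i\<in>I. \<Sum>b\<in>B. \<beta> b * (fst b i * x i))"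
        unfolding ip_def by (simp add: sum_distrib_right mult.assoc)
      also have "\<dots> = (\<Sum>b\<in>B. \<beta> b * ip (fst b) x)"
        unfolding ip_def by (subst sum.swap) (simp add: sum_distrib_left)
      finally show "ip (fst l) x = 0" using x by simp
    qed
    have "B \<noteq> {}"
      using uniq[of "\<lambda>_. 1"] I(2) by auto
    obtain ys where ys: "set ys = B" "length ys = card B"
      using B(2) finite_distinct_list distinct_card by metis
    \<comment> \<open>Padding with a repeated wall gives the exact length \<open>card I\<close>;
      \<open>hd\<close> is meaningful as \<open>B\<close> is nonempty.\<close>
    define xs where "xs = ys @ replicate (card I - card B) (hd ys)"
    have "ys \<noteq> []" using ys \<open>B \<noteq> {}\<close> by auto
    then have "set xs = B" using ys by (auto simp: xs_def)
    moreover have "length xs = card I" using ys B(3) by (simp add: xs_def)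
    ultimately have xs: "xs \<in> X" "set xs = B" using B(1) by (auto simp: X_def T_def)
    define v' where "v' = (\<lambda>i. if i \<in> I then v i else 0)"
    have ipv': "ip a v' = ip a v" for a unfolding ip_def v'_def by (intro sum.cong) auto
    have "sol xs = v'"
      unfolding sol_def
    proof (rule some_equality)
      show "(\<forall>i. i \<notin> I \<longrightarrow> v' i = 0) \<and> (\<forall>l\<in>set xs. ip (fst l) v' = snd l)"
        using xs B(1) by (auto simp: v'_def T_def ipv'[unfolded v'_def])
      fix x assume x: "(\<forall>i. i \<notin> I \<longrightarrow> x i = 0) \<and> (\<forall>l\<in>set xs. ip (fst l) x = snd l)"
      have "ip (fst l) (\<lambda>i. x i - v' i) = 0" if "l \<in> B" for l
      proof -
        have "ip (fst l) (\<lambda>i. x i - v' i) = ip (fst l) x - ip (fst l) v'"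
          unfolding ip_def by (simp add: right_diff_distrib sum_subtractf)
        then show ?thesis using x that xs B(1) by (auto simp: ipv' T_def)
      qed
      then have "x i - v' i = 0" if "i \<in> I" for i using uniq[of "\<lambda>i. x i - v' i" i] that by blast
      then show "x = v'" using x by (auto simp: v'_def fun_eq_iff)
    qed
    then have "v' \<in> sol ` X" using xs(1) by blast
    then have "v' \<in> N" using v(1) by (auto simp: N_def v'_def)
    have "E \<le> (\<Sum>j\<in>J. max 0 (ip (psi j) v')) + ip g v'"
      using N[OF \<open>v' \<in> N\<close>] by (simp add: ip_def)
    then have "E \<le> (\<Sum>j\<in>J. max 0 (ip (psi j) v)) + ip g v" unfolding ipv' .
    then show "E \<le> (\<Sum>j\<in>J. max 0 (\<Sum>i\<in>I. psi j i * u i)) + (\<Sum>i\<in>I. g i * u i)"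
      using v(2) unfolding ip_def by linarith
  qed
qed

section \<open>Switches in a perfect matching\<close>

text \<open>The partner map of a perfect matching, with unconstrained values outside
  \<open>V\<close>. A switch is then a mere function update.\<close>

definition pairing :: "'a set \<Rightarrow> ('a \<Rightarrow> 'a) \<Rightarrow> bool" where
  "pairing V p \<longleftrightarrow> (\<forall>a\<in>V. p a \<in> V \<and> p a \<noteq> a \<and> p (p a) = a)"

text \<open>Every matching edge is seen from both of its ends, whence the division by 2.\<close>

definition edge_count :: "'a set \<Rightarrow> ('a set \<Rightarrow> 'i) \<Rightarrow> ('a \<Rightarrow> 'a) \<Rightarrow> 'i \<Rightarrow> real" where
  "edge_count V c p i = (\<Sum>a\<in>V. of_bool (c {a, p a} = i)) / 2"

text \<open>
  The change of the colour counts when the edges at \<open>fst q\<close> and \<open>snd q\<close> are replaced by the two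
  edges joining these vertices and joining their partners.
\<close>

definition switch_gain :: "('a set \<Rightarrow> 'i) \<Rightarrow> ('a \<Rightarrow> 'a) \<Rightarrow> 'a \<times> 'a \<Rightarrow> 'i \<Rightarrow> real" where
  "switch_gain c p q i =
     of_bool (c {fst q, snd q} = i) + of_bool (c {p (fst q), p (snd q)} = i)
     - of_bool (c {fst q, p (fst q)} = i) - of_bool (c {snd q, p (snd q)} = i)"

lemma switch_one:
  fixes c :: "'a set \<Rightarrow> 'i"
  assumes V: "finite V" and p: "pairing V p"
    and q: "a \<in> V" "b \<in> V" "b \<noteq> a" "b \<noteq> p a"
  obtains p' where "pairing V p'" "\<And>x. x \<notin> quad p (a, b) \<Longrightarrow> p' x = p x"
    "\<And>i. edge_count V c p' i = edge_count V c p i + switch_gain c p (a, b) i"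
proof -
  define p' where "p' = p(a := b, b := a, p a := p b, p b := p a)"
  have pp: "p a \<in> V" "p b \<in> V" "p (p a) = a" "p (p b) = b" "p a \<noteq> a" "p b \<noteq> b"
    using p q by (auto simp: pairing_def)
  have ne: "p b \<noteq> a" "p a \<noteq> p b"
    using pp q by metis+
  have vals: "p' a = b" "p' b = a" "p' (p a) = p b" "p' (p b) = p a"
    using pp q ne by (auto simp: p'_def)
  have other: "p' x = p x" if "x \<notin> quad p (a, b)" for x
    using that by (auto simp: p'_def quad_def)
  \<comment> \<open>The four vertices are closed under the involution, hence so is their complement,
    where \<open>p'\<close> agrees with \<open>p\<close>.\<close>
  have closed: "p x \<notin> quad p (a, b)" if "x \<in> V" "x \<notin> quad p (a, b)" for x
  proof
    assume "p x \<in> quad p (a, b)"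
    then have "p (p x) \<in> quad p (a, b)" using pp by (auto simp: quad_def)
    then show False using that p by (auto simp: pairing_def)
  qed
  have "pairing V p'"
    unfolding pairing_def
  proof
    fix x assume x: "x \<in> V"
    show "p' x \<in> V \<and> p' x \<noteq> x \<and> p' (p' x) = x"
    proof (cases "x \<in> quad p (a, b)")
      case True
      then consider "x = a" | "x = b" | "x = p a" | "x = p b" by (auto simp: quad_def)
      then show ?thesis using vals pp q ne by cases auto
    next
      case False
      then show ?thesis using other[OF False] other[OF closed[OF x False]] p x
        by (auto simp: pairing_def)
    qed
  qed
  moreover have "edge_count V c p' i = edge_count V c p i + switch_gain c p (a, b) i" for i
  proof -
    have D: "quad p (a, b) \<subseteq> V" using pp q by (auto simp: quad_def)
    have split: "(\<Sum>x\<in>V. f x) = (\<Sum>x\<in>V - quad p (a, b). f x) + f a + f b + f (p a) + f (p b)"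
      for f :: "'a \<Rightarrow> real"
    proof -
      have "(\<Sum>x\<in>quad p (a, b). f x) = f a + f b + f (p a) + f (p b)"
        using pp q ne by (simp add: quad_def sum.insert_if insert_commute eq_commute)
      then show ?thesis using sum.subset_diff[OF D V, of f] by simp
    qed
    have "(\<Sum>x\<in>V - quad p (a, b). of_bool (c {x, p' x} = i))
        = (\<Sum>x\<in>V - quad p (a, b). (of_bool (c {x, p x} = i) :: real))"
      by (intro sum.cong) (auto simp: other)
    then show ?thesis
      unfolding edge_count_def split vals pp
      by (simp add: switch_gain_def insert_commute field_simps)
  qed
  ultimately show thesis using that[of p'] other by blast
qed

text \<open>A switch alters partners only inside its own \<open>quad\<close>, so the gain of a later
  disjoint switch is still the one computed from \<open>p\<close>. The clause on unchanged partners
  carries this through the induction.\<close>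

lemma switch_disjoint_pairs:
  fixes c :: "'a set \<Rightarrow> 'i"
  assumes V: "finite V" and p: "pairing V p"
    and Q: "finite Q" "Q \<subseteq> V \<times> V" "disjoint_family_on (quad p) Q" "\<forall>(a, b)\<in>Q. b \<noteq> a \<and> b \<noteq> p a"
  shows "\<exists>p'. pairing V p' \<and> (\<forall>x. x \<notin> \<Union>(quad p ` Q) \<longrightarrow> p' x = p x) \<and>
    (\<forall>i. edge_count V c p' i = edge_count V c p i + (\<Sum>q\<in>Q. switch_gain c p q i))"
  using Q
proof (induction Q rule: finite_induct)
  case empty
  then show ?case using p by auto
next
  case (insert q Q)
  obtain p1 where p1: "pairing V p1" "\<And>x. x \<notin> \<Union>(quad p ` Q) \<Longrightarrow> p1 x = p x"
    "\<And>i. edge_count V c p1 i = edge_count V c p i + (\<Sum>q\<in>Q. switch_gain c p q i)"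
    using insert by (auto simp: disjoint_family_on_def)
  obtain a b where ab: "q = (a, b)" by (cases q)
  have "quad p q \<inter> \<Union>(quad p ` Q) = {}"
    using insert.prems(2) insert.hyps(2) by (auto simp: disjoint_family_on_insert)
  then have same: "p1 x = p x" if "x \<in> quad p q" for x using that p1(2) by blast
  have "p1 a = p a" "p1 b = p b" using same by (auto simp: ab quad_def)
  then have same': "quad p1 q = quad p q" "switch_gain c p1 q = switch_gain c p q"
    by (auto simp: ab quad_def switch_gain_def)
  obtain p2 where p2: "pairing V p2" "\<And>x. x \<notin> quad p1 q \<Longrightarrow> p2 x = p1 x"
    "\<And>i. edge_count V c p2 i = edge_count V c p1 i + switch_gain c p1 q i"
    using switch_one[OF V p1(1), of a b c] insert.prems \<open>p1 a = p a\<close> ab by auto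
  show ?case
    using p2 p1 insert.hyps by (intro exI[of _ p2]) (auto simp: same')
qed

lemma sum_abs_switch_gain:
  assumes "finite I"
  shows "(\<Sum>i\<in>I. \<bar>switch_gain c p q i\<bar>) \<le> 4"
proof -
  have le1: "(\<Sum>i\<in>I. of_bool (x = i)) \<le> (1 :: real)" for x
    using assms by (auto simp: of_bool_def)
  have "(\<Sum>i\<in>I. \<bar>switch_gain c p q i\<bar>)
    \<le> (\<Sum>i\<in>I. of_bool (c {fst q, snd q} = i) + of_bool (c {p (fst q), p (snd q)} = i)
      + of_bool (c {fst q, p (fst q)} = i) + of_bool (c {snd q, p (snd q)} = i))"
    by (intro sum_mono) (auto simp: switch_gain_def)
  also have "\<dots> \<le> 1 + 1 + 1 + 1"
    unfolding sum.distrib by (intro add_mono le1)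
  finally show ?thesis by simp
qed

text \<open>Since \<open>p\<close> permutes \<open>V\<close>, both new edges run over all ordered
  pairs, while an old edge is met \<open>card V - 1\<close> times from each end. For a balanced
  colouring the total is \<open>- 4 * real (card V - 1)\<close> times the excess. Pairs
  \<open>(a, p a)\<close> may be included, as their gain is 0.\<close>

lemma sum_switch_gain:
  fixes c :: "'a set \<Rightarrow> 'i"
  assumes V: "finite V" and p: "pairing V p"
  shows "(\<Sum>a\<in>V. \<Sum>b\<in>V - {a}. switch_gain c p (a, b) i)
    = 2 * (\<Sum>a\<in>V. \<Sum>b\<in>V - {a}. of_bool (c {a, b} = i))
      - 4 * real (card V - 1) * edge_count V c p i"
proof -
  have bij: "bij_betw p V V"
    by (rule bij_betwI[where g = p]) (use p in \<open>auto simp: pairing_def\<close>)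
  have inj: "x = y" if "x \<in> V" "y \<in> V" "p x = p y" for x y
    using that p by (metis pairing_def)
  have bij': "bij_betw p (V - {a}) (V - {p a})" if "a \<in> V" for a
    by (rule bij_betwI[where g = p]) (use p that in \<open>auto simp: pairing_def dest: inj\<close>)
  have 1: "(\<Sum>a\<in>V. \<Sum>b\<in>V - {a}. of_bool (c {p a, p b} = i))
      = (\<Sum>a\<in>V. \<Sum>b\<in>V - {a}. (of_bool (c {a, b} = i) :: real))"
  proof -
    have "(\<Sum>a\<in>V. \<Sum>b\<in>V - {a}. (of_bool (c {p a, p b} = i) :: real))
      = (\<Sum>a\<in>V. \<Sum>b\<in>V - {p a}. of_bool (c {p a, b} = i))"
      by (intro sum.cong refl sum.reindex_bij_betw bij')
    also have "\<dots> = (\<Sum>a\<in>V. \<Sum>b\<in>V - {a}. of_bool (c {a, b} = i))"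
      by (rule sum.reindex_bij_betw[OF bij])
    finally show ?thesis .
  qed
  have 2: "(\<Sum>a\<in>V. \<Sum>b\<in>V - {a}. of_bool (c {a, p a} = i))
      = real (card V - 1) * (2 * edge_count V c p i)"
    using V by (simp add: edge_count_def sum_distrib_left card_Diff_singleton cong: sum.cong)
  have 3: "(\<Sum>a\<in>V. \<Sum>b\<in>V - {a}. (of_bool (c {b, p b} = i) :: real))
      = real (card V - 1) * (2 * edge_count V c p i)"
  proof -
    have "(\<Sum>a\<in>V. \<Sum>b\<in>V - {a}. (of_bool (c {b, p b} = i) :: real))
      = (\<Sum>a\<in>V. \<Sum>b\<in>{b \<in> V. b \<noteq> a}. of_bool (c {b, p b} = i))"
      by (intro sum.cong) auto
    also have "\<dots> = (\<Sum>b\<in>V. \<Sum>a\<in>{a \<in> V. b \<noteq> a}. of_bool (c {b, p b} = i))"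
      by (rule sum.swap_restrict[OF V V])
    also have "\<dots> = (\<Sum>a\<in>V. \<Sum>b\<in>V - {a}. of_bool (c {a, p a} = i))"
      by (intro sum.cong) auto
    finally show ?thesis using 2 by simp
  qed
  show ?thesis
    unfolding switch_gain_def fst_conv snd_conv sum.distrib sum_subtractf 1 2 3
    by simp
qed

section \<open>One round of improvement and its iteration limit\<close>

definition deviation :: "'i set \<Rightarrow> real \<Rightarrow> 'a set \<Rightarrow> ('a set \<Rightarrow> 'i) \<Rightarrow> ('a \<Rightarrow> 'a) \<Rightarrow> real" where
  "deviation I t V c p = (\<Sum>i\<in>I. \<bar>edge_count V c p i - t\<bar>)"

text \<open>
  The support function of a zonotope of switches changes its linear form only across the
  homogeneous hyperplanes below; the others are the facets of the cube.
\<close>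

definition walls :: "'i set \<Rightarrow> (('i \<Rightarrow> real) \<times> real) set" where
  "walls I = (\<lambda>((a, b), (d, e)).
       (\<lambda>i. of_bool (a = i) + of_bool (b = i) - of_bool (d = i) - of_bool (e = i), 0)) ` ((I \<times> I) \<times> (I \<times> I))
     \<union> (\<lambda>i. (indicator {i}, 1)) ` I \<union> (\<lambda>i. (indicator {i}, -1)) ` I"

lemma finite_walls: "finite I \<Longrightarrow> finite (walls I)"
  unfolding walls_def by (intro finite_UnI finite_imageI finite_cartesian_product)

lemma card_walls_le:
  assumes "finite I" "I \<noteq> {}"
  shows "card (walls I) \<le> 3 * card I ^ 4"
proof -
  let ?k = "card I"
  have "card (walls I) \<le> card ((I \<times> I) \<times> (I \<times> I)) + card I + card I"
    unfolding walls_def using assms(1)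
    by (intro order.trans[OF card_Un_le] add_mono card_image_le finite_cartesian_product)
  moreover have "card ((I \<times> I) \<times> (I \<times> I)) = ?k ^ 4"
    by (simp add: card_cartesian_product power4_eq_xxxx mult.assoc)
  moreover have "?k \<le> ?k ^ 4"
    by (rule self_le_power) (use assms in \<open>auto simp: Suc_le_eq card_gt_0_iff\<close>)
  ultimately show ?thesis by linarith
qed

text \<open>Trading \<open>ln k\<close> for \<open>sqrt k\<close> is affordable: the passage from
  the Euclidean norm to the 1-norm costs another \<open>sqrt k\<close>, and the product is of order
  \<open>k\<^sup>2\<close>.\<close>

lemma ln_card_power_bound:
  assumes "m \<le> (3 * k ^ 4) ^ k" "k \<ge> 1"
  shows "ln (real m) \<le> 8 * real k * sqrt (real k)"
proof (cases "m = 0")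
  case False
  have "ln (real m) \<le> ln (real ((3 * k ^ 4) ^ k))"
    using assms False by (intro ln_mono) (simp_all del: of_nat_power of_nat_mult)
  also have "\<dots> = real k * (ln 3 + 4 * ln (real k))"
    using assms(2) by (simp add: ln_realpow ln_mult distrib_left)
  also have "ln (real k) = 2 * ln (sqrt (real k))"
    using assms(2) by (simp add: ln_sqrt)
  also have "ln 3 + 4 * (2 * ln (sqrt (real k))) \<le> 8 * sqrt (real k)"
    using ln_le_minus_one[of "sqrt (real k)"] ln_le_minus_one[of "3 :: real"] assms(2) by simp
  finally show ?thesis by (simp add: mult_left_mono)
qed simp

text \<open>Carrying out the rounded set of switches turns the excess \<open>d\<close> into
  \<open>7/8 * d\<close>, up to the distance from the zonotope and the rounding error. These cost
  \<open>80 * k\<^sup>2\<close> and \<open>4 * k\<close>, whence 84.\<close>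

lemma improve_pairing:
  fixes c :: "'a set \<Rightarrow> 'i" and t :: real
  assumes V: "finite V" "V \<noteq> {}" and I: "finite I" "I \<noteq> {}"
    and col: "\<forall>a\<in>V. \<forall>b\<in>V - {a}. c {a, b} \<in> I"
    and bal: "\<forall>i\<in>I. (\<Sum>a\<in>V. \<Sum>b\<in>V - {a}. of_bool (c {a, b} = i)) = 2 * t * real (card V - 1)"
    and p: "pairing V p"
  obtains p' where "pairing V p'"
    "deviation I t V c p' \<le> 7 / 8 * deviation I t V c p + 84 * (real (card I))\<^sup>2"
proof -
  define k where "k = card I"
  define d where "d = (\<lambda>i. edge_count V c p i - t)"
  have k1: "k \<ge> 1" using I by (simp add: k_def Suc_le_eq card_gt_0_iff)
  have cardV: "card V \<ge> 2"
  proof -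
    obtain a where "a \<in> V" using V by blast
    then have "{a, p a} \<subseteq> V" "card {a, p a} = 2" using p by (auto simp: pairing_def)
    then show ?thesis using card_mono[OF V(1)] by metis
  qed
  have cube: "\<forall>i\<in>I. (indicator {i}, 1) \<in> walls I \<and> (indicator {i}, -1) \<in> walls I"
    by (auto simp: walls_def)
  have gain_wall: "(switch_gain c p (a, b), 0) \<in> walls I"
    if "a \<in> V" "b \<in> V" "b \<noteq> a" "b \<noteq> p a" for a b
  proof -
    have "p a \<in> V" "p b \<in> V" "p a \<noteq> a" "p b \<noteq> b" "p a \<noteq> p b"
      using p that by (auto simp: pairing_def) metis
    then have "c {a, b} \<in> I" "c {p a, p b} \<in> I" "c {a, p a} \<in> I" "c {b, p b} \<in> I"
      using that col by auto
    moreover have "switch_gain c p (a, b) = (\<lambda>i. of_bool (c {a, b} = i) + of_bool (c {p a, p b} = i)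
        - of_bool (c {a, p a} = i) - of_bool (c {b, p b} = i))"
      by (simp add: switch_gain_def fun_eq_iff)
    ultimately show ?thesis unfolding walls_def
      by (intro UnI1 image_eqI[where x = "((c {a, b}, c {p a, p b}), (c {a, p a}, c {b, p b}))"]) auto
  qed
  \<comment> \<open>\<open>N\<close> depends on \<open>I\<close> alone, which avoids a circularity:
    the greedy choice needs the test directions, while the zonotope to be tested depends on that
    choice.\<close>
  obtain N :: "('i \<Rightarrow> real) set" where N: "finite N" "card N \<le> card (walls I) ^ card I"
    "\<And>v i. v \<in> N \<Longrightarrow> \<bar>v i\<bar> \<le> 1"
    and test: "\<And>(J :: ('a \<times> 'a) set) psi g E u.
      \<lbrakk>finite J; \<And>j. j \<in> J \<Longrightarrow> (psi j, 0) \<in> walls I; \<And>i. \<bar>u i\<bar> \<le> 1;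
        \<And>v. v \<in> N \<Longrightarrow> E \<le> (\<Sum>j\<in>J. max 0 (\<Sum>i\<in>I. psi j i * v i)) + (\<Sum>i\<in>I. g i * v i)\<rbrakk>
      \<Longrightarrow> E \<le> (\<Sum>j\<in>J. max 0 (\<Sum>i\<in>I. psi j i * u i)) + (\<Sum>i\<in>I. g i * u i)"
    by (fact finite_test_set[where 'j = "'a \<times> 'a", OF I finite_walls[OF I(1)] cube])
  define lnN where "lnN = ln (real (card N))"
  have "card N \<le> (3 * k ^ 4) ^ k"
    using N(2) power_mono[OF card_walls_le[OF I], of k] by (simp add: k_def)
  then have lnN: "lnN \<le> 8 * real k * sqrt (real k)"
    unfolding lnN_def by (rule ln_card_power_bound) (rule k1)
  \<comment> \<open>The diagonal is set to 0: for \<open>b = a\<close> the gain formula does not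
    describe a switch and need not vanish.\<close>
  define y where "y = (\<lambda>u a b. if b = a then 0 else max 0 (\<Sum>i\<in>I. switch_gain c p (a, b) i * u i))"
  have y4: "y u a b \<le> 4" if "u \<in> N" for u a b
  proof -
    have "(\<Sum>i\<in>I. switch_gain c p (a, b) i * u i) \<le> (\<Sum>i\<in>I. \<bar>switch_gain c p (a, b) i\<bar>)"
    proof (intro sum_mono)
      fix i
      have "\<bar>switch_gain c p (a, b) i\<bar> * \<bar>u i\<bar> \<le> \<bar>switch_gain c p (a, b) i\<bar>"
        using N(3)[OF that] by (intro mult_left_le) auto
      then show "switch_gain c p (a, b) i * u i \<le> \<bar>switch_gain c p (a, b) i\<bar>"
        by (metis abs_ge_self abs_mult order.trans)
    qed
    also have "\<dots> \<le> 4" by (rule sum_abs_switch_gain[OF I(1)])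
    finally show ?thesis by (simp add: y_def)
  qed
  \<comment> \<open>Cutting off at \<open>V\<close> secures \<open>zp\<close> for every
    \<open>a\<close>, as \<open>p\<close> need not be an involution outside
    \<open>V\<close>.\<close>
  define z where "z = (\<lambda>u a b. if a \<in> V then y u a b else 0)"
  have zp: "z u a (p a) = 0" for u a
    using p by (auto simp: z_def y_def switch_gain_def pairing_def insert_commute)
  have "\<exists>Q. Q \<subseteq> V \<times> V \<and> disjoint_family_on (quad p) Q \<and> (\<forall>(a, b)\<in>Q. b \<noteq> a \<and> b \<noteq> p a) \<and>
    (\<forall>u\<in>N. (\<Sum>a\<in>V. \<Sum>b\<in>V. z u a b) / real (card V)
       \<le> 16 * (\<Sum>(a, b)\<in>Q. z u a b) + 160 * ln (real (card N)))"
  proof (rule greedy_pairs_log)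
    show "z u a b \<le> 4" if "u \<in> N" for u a b using y4[OF that] by (simp add: z_def)
    show "p ` V \<subseteq> V" "\<And>a. a \<in> V \<Longrightarrow> p (p a) = a" using p by (auto simp: pairing_def)
  qed (use N(1) V zp in \<open>auto simp: z_def y_def\<close>)
  then obtain Q where Q: "Q \<subseteq> V \<times> V" "disjoint_family_on (quad p) Q"
    "\<forall>(a, b)\<in>Q. b \<noteq> a \<and> b \<noteq> p a"
    "\<And>u. u \<in> N \<Longrightarrow> (\<Sum>a\<in>V. \<Sum>b\<in>V. z u a b) / real (card V)
       \<le> 16 * (\<Sum>(a, b)\<in>Q. z u a b) + 160 * ln (real (card N))"
    by blast
  have finQ: "finite Q" using Q(1) V(1) by (auto intro: finite_subset)
  have testN: "- 10 * lnN \<le> (\<Sum>q\<in>Q. max 0 (\<Sum>i\<in>I. switch_gain c p q i * u i)) + (\<Sum>i\<in>I. d i / 8 * u i)"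
    if u: "u \<in> N" for u
  proof -
    define D where "D = (\<Sum>i\<in>I. d i * u i)"
    define X where "X = (\<Sum>q\<in>Q. max 0 (\<Sum>i\<in>I. switch_gain c p q i * u i))"
    have Xz: "(\<Sum>(a, b)\<in>Q. z u a b) = X"
      unfolding X_def using Q(1,3) by (intro sum.cong) (auto simp: z_def y_def)
    have X0: "X \<ge> 0" unfolding X_def by (intro sum_nonneg) simp
    have "card N \<ge> 1" using u N(1) by (auto simp: Suc_le_eq card_gt_0_iff)
    then have ln0: "lnN \<ge> 0" by (simp add: lnN_def)
    have "- 4 * real (card V - 1) * D
      = (\<Sum>i\<in>I. (2 * (2 * t * real (card V - 1)) - 4 * real (card V - 1) * edge_count V c p i) * u i)"
      unfolding D_def d_def sum_distrib_left by (intro sum.cong) (auto simp: algebra_simps)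
    also have "\<dots> = (\<Sum>i\<in>I. (\<Sum>a\<in>V. \<Sum>b\<in>V - {a}. switch_gain c p (a, b) i) * u i)"
      by (intro sum.cong) (simp_all add: sum_switch_gain[OF V(1) p] bal)
    also have "\<dots> = (\<Sum>i\<in>I. \<Sum>a\<in>V. \<Sum>b\<in>V - {a}. switch_gain c p (a, b) i * u i)"
      by (simp add: sum_distrib_right)
    also have "\<dots> = (\<Sum>a\<in>V. \<Sum>i\<in>I. \<Sum>b\<in>V - {a}. switch_gain c p (a, b) i * u i)"
      by (rule sum.swap)
    also have "\<dots> = (\<Sum>a\<in>V. \<Sum>b\<in>V - {a}. \<Sum>i\<in>I. switch_gain c p (a, b) i * u i)"
      by (intro sum.cong refl sum.swap)
    also have "\<dots> \<le> (\<Sum>a\<in>V. \<Sum>b\<in>V - {a}. z u a b)"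
      by (intro sum_mono) (auto simp: z_def y_def)
    also have "\<dots> \<le> (\<Sum>a\<in>V. \<Sum>b\<in>V. z u a b)"
      using V(1) by (intro sum_mono sum_mono2) (auto simp: z_def y_def)
    also have "\<dots> \<le> real (card V) * (16 * X + 160 * lnN)"
      using Q(4)[OF u] cardV unfolding Xz lnN_def by (simp add: divide_le_eq mult.commute)
    finally have main: "- 4 * real (card V - 1) * D \<le> real (card V) * (16 * X + 160 * lnN)" .
    have "- D \<le> 8 * X + 80 * lnN"
    proof (cases "D \<le> 0")
      case True
      \<comment> \<open>\<open>card V - 1\<close> is at least half of \<open>card V\<close>.
        Together with the greedy factor 16 this yields the fraction 1/8 of \<open>d\<close>.\<close>
      have "2 * real (card V) \<le> 4 * real (card V - 1)" using cardV by (simp add: of_nat_diff)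
      then have "2 * real (card V) * (- D) \<le> 4 * real (card V - 1) * (- D)"
        using True by (intro mult_right_mono) auto
      also have "\<dots> \<le> real (card V) * (16 * X + 160 * lnN)" using main by simp
      finally have "real (card V) * (2 * (- D)) \<le> real (card V) * (16 * X + 160 * lnN)"
        by (simp add: mult_ac)
      then have "2 * (- D) \<le> 16 * X + 160 * lnN"
        by (rule mult_left_le_imp_le) (use cardV in simp)
      then show ?thesis by simp
    next
      case False
      then show ?thesis using X0 ln0 by linarith
    qed
    moreover have "(\<Sum>i\<in>I. d i / 8 * u i) = D / 8"
      by (simp add: D_def sum_divide_distrib)
    ultimately show ?thesis unfolding X_def[symmetric] by simp
  qed
  have supp: "(\<Sum>i\<in>I. u i * (- d i / 8))
      \<le> (\<Sum>q\<in>Q. max 0 (\<Sum>i\<in>I. u i * switch_gain c p q i)) + 10 * lnN"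
    if u: "\<And>i. \<bar>u i\<bar> \<le> 1" for u
  proof -
    \<comment> \<open>By the choice of \<open>N\<close>, the inequality passes from the test
      directions to the whole cube.\<close>
    have "- 10 * lnN \<le> (\<Sum>q\<in>Q. max 0 (\<Sum>i\<in>I. switch_gain c p q i * u i)) + (\<Sum>i\<in>I. d i / 8 * u i)"
    proof (rule test[OF finQ _ u testN])
      fix q assume "q \<in> Q"
      then show "(switch_gain c p q, 0) \<in> walls I"
        using Q(1,3) by (cases q) (auto intro!: gain_wall)
    qed
    moreover have "(\<Sum>i\<in>I. u i * (- d i / 8)) = - (\<Sum>i\<in>I. d i / 8 * u i)"
      by (simp add: sum_negf[symmetric] mult.commute)
    ultimately show ?thesis by (simp add: mult.commute)
  qed
  obtain l where l: "\<And>q. q \<in> Q \<Longrightarrow> 0 \<le> l q \<and> l q \<le> 1"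
    and near: "(\<Sum>i\<in>I. (- d i / 8 - (\<Sum>q\<in>Q. l q * switch_gain c p q i))\<^sup>2) \<le> (10 * lnN)\<^sup>2"
    using zonotope_approximation[OF I(1) finQ supp] by blast
  have lnN0: "lnN \<ge> 0" using supp[of "\<lambda>_. 0"] by simp
  define r where "r = (\<lambda>i. - d i / 8 - (\<Sum>q\<in>Q. l q * switch_gain c p q i))"
  have r: "(\<Sum>i\<in>I. \<bar>r i\<bar>) \<le> 80 * (real k)\<^sup>2"
  proof (rule power2_le_imp_le)
    \<comment> \<open>Cauchy-Schwarz, at the price of a factor \<open>k\<close> between the
      squares.\<close>
    have "(\<Sum>i\<in>I. \<bar>r i\<bar>)\<^sup>2 \<le> (\<Sum>i\<in>I. \<bar>r i\<bar>\<^sup>2) * real k"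
      unfolding k_def using sum_squared_le_sum_of_squares[of "\<lambda>i. \<bar>r i\<bar>" I]
      by (simp add: mult.commute)
    also have "(\<Sum>i\<in>I. \<bar>r i\<bar>\<^sup>2) \<le> (10 * lnN)\<^sup>2" using near by (simp add: r_def)
    also have "(10 * lnN)\<^sup>2 \<le> (10 * (8 * real k * sqrt (real k)))\<^sup>2"
      using lnN lnN0 by (intro power_mono mult_left_mono) auto
    also have "(10 * (8 * real k * sqrt (real k)))\<^sup>2 * real k = (80 * (real k)\<^sup>2)\<^sup>2"
      by (simp add: power_mult_distrib power2_eq_square)
    finally show "(\<Sum>i\<in>I. \<bar>r i\<bar>)\<^sup>2 \<le> (80 * (real k)\<^sup>2)\<^sup>2"
      by (simp add: mult_right_mono)
  qed simp
  have small: "\<And>q. q \<in> Q \<Longrightarrow> (\<Sum>i\<in>I. \<bar>switch_gain c p q i\<bar>) \<le> 4"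
    by (rule sum_abs_switch_gain[OF I(1)])
  obtain Q' where Q': "Q' \<subseteq> Q" "(\<Sum>i\<in>I. \<bar>(\<Sum>q\<in>Q'. switch_gain c p q i)
      - (\<Sum>q\<in>Q. l q * switch_gain c p q i)\<bar>) \<le> 4 * real (card I)"
    by (rule round_coefficients[of I Q l "switch_gain c p" 4]) (use I(1) finQ l small in auto)
  have Q'V: "finite Q'" "Q' \<subseteq> V \<times> V" "disjoint_family_on (quad p) Q'"
    "\<forall>(a, b)\<in>Q'. b \<noteq> a \<and> b \<noteq> p a"
    using Q(1-3) Q'(1) finQ by (auto intro: finite_subset disjoint_family_on_mono)
  obtain p' where p': "pairing V p'"
    "\<And>i. edge_count V c p' i = edge_count V c p i + (\<Sum>q\<in>Q'. switch_gain c p q i)"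
    using switch_disjoint_pairs[OF V(1) p Q'V, of c] by blast
  show thesis
  proof (rule that[OF p'(1)])
    have "deviation I t V c p' \<le> (\<Sum>i\<in>I. 7 / 8 * \<bar>d i\<bar> + \<bar>r i\<bar>
        + \<bar>(\<Sum>q\<in>Q'. switch_gain c p q i) - (\<Sum>q\<in>Q. l q * switch_gain c p q i)\<bar>)"
      unfolding deviation_def
    proof (rule sum_mono)
      fix i
      have "edge_count V c p' i - t = 7 / 8 * d i - r i
          + ((\<Sum>q\<in>Q'. switch_gain c p q i) - (\<Sum>q\<in>Q. l q * switch_gain c p q i))"
        by (simp add: p'(2) d_def r_def field_simps)
      then show "\<bar>edge_count V c p' i - t\<bar> \<le> 7 / 8 * \<bar>d i\<bar> + \<bar>r i\<bar>
          + \<bar>(\<Sum>q\<in>Q'. switch_gain c p q i) - (\<Sum>q\<in>Q. l q * switch_gain c p q i)\<bar>"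
        by linarith
    qed
    also have "\<dots> = 7 / 8 * deviation I t V c p + (\<Sum>i\<in>I. \<bar>r i\<bar>)
        + (\<Sum>i\<in>I. \<bar>(\<Sum>q\<in>Q'. switch_gain c p q i) - (\<Sum>q\<in>Q. l q * switch_gain c p q i)\<bar>)"
      by (simp add: sum.distrib deviation_def d_def sum_distrib_left)
    also have "\<dots> \<le> 7 / 8 * deviation I t V c p + 80 * (real k)\<^sup>2 + 4 * real k"
      using r Q'(2) by (simp add: k_def)
    finally have "deviation I t V c p'
      \<le> 7 / 8 * deviation I t V c p + 80 * (real k)\<^sup>2 + 4 * real k" .
    moreover have "real k \<le> (real k)\<^sup>2" using k1 by (simp add: power2_eq_square)
    ultimately show "deviation I t V c p' \<le> 7 / 8 * deviation I t V c p + 84 * (real (card I))\<^sup>2"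
      unfolding k_def[symmetric] by linarith
  qed
qed

text \<open>Let \<open>x\<close> be a deviation within \<open>K = k\<^sup>2\<close> of the infimum,
  where \<open>k = card I\<close>. One more round stays above the infimum, so
  \<open>x - K < 7/8 * x + 84 * K\<close>, that is, \<open>x < 8 * 85 * K\<close>.\<close>

lemma small_deviation_pairing:
  fixes c :: "'a set \<Rightarrow> 'i" and t :: real
  assumes V: "finite V" "V \<noteq> {}" and I: "finite I" "I \<noteq> {}"
    and col: "\<forall>a\<in>V. \<forall>b\<in>V - {a}. c {a, b} \<in> I"
    and bal: "\<forall>i\<in>I. (\<Sum>a\<in>V. \<Sum>b\<in>V - {a}. of_bool (c {a, b} = i)) = 2 * t * real (card V - 1)"
    and p: "pairing V p"
  obtains p' where "pairing V p'" "deviation I t V c p' \<le> 680 * (real (card I))\<^sup>2"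
proof -
  let ?K = "(real (card I))\<^sup>2"
  define A where "A = deviation I t V c ` {p. pairing V p}"
  have K: "?K > 0" using I by (simp add: card_gt_0_iff)
  have bdd: "bdd_below A"
    by (rule bdd_belowI[of _ 0]) (auto simp: A_def deviation_def intro: sum_nonneg)
  have "A \<noteq> {}" using p by (auto simp: A_def)
  then obtain x where "x \<in> A" "x < Inf A + ?K"
    using cInf_lessD[of A "Inf A + ?K"] K by auto
  then obtain q where q: "pairing V q" "deviation I t V c q < Inf A + ?K" by (auto simp: A_def)
  obtain q' where q': "pairing V q'"
    "deviation I t V c q' \<le> 7 / 8 * deviation I t V c q + 84 * ?K"
    using improve_pairing[OF V I col bal q(1)] by blast
  have "Inf A \<le> deviation I t V c q'" using q'(1) bdd by (intro cInf_lower) (auto simp: A_def)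
  then have "deviation I t V c q \<le> 680 * ?K" using q q' by linarith
  then show thesis using that q(1) by blast
qed

section \<open>From partner maps back to edge sets of the complete graph\<close>

lemma count_ordered_pairs:
  assumes V: "finite V" and F: "F \<subseteq> nsets V 2"
  shows "(\<Sum>a\<in>V. \<Sum>b\<in>V - {a}. of_bool ({a, b} \<in> F)) = 2 * real (card F)"
proof -
  have finF: "finite F" using F V by (rule finite_subset[OF _ finite_imp_finite_nsets])
  have mem: "a \<in> V \<and> b \<in> V \<and> a \<noteq> b" if "{a, b} \<in> F" for a b
    using F that by (auto simp: nsets_def)
  have ends: "{(a, b). {a, b} = e} = {(x, y), (y, x)}" if "e = {x, y}" for e :: "'a set" and x y
    using that by (auto simp: doubleton_eq_iff)
  have two: "finite {(a, b). {a, b} = e} \<and> card {(a, b). {a, b} = e} = 2" if "e \<in> F" for e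
  proof -
    have "card e = 2" using F that by (auto simp: nsets_def)
    then obtain x y where "e = {x, y}" "x \<noteq> y" by (auto simp: card_2_iff)
    then show ?thesis using ends[of e x y] by simp
  qed
  have "(\<Sum>a\<in>V. \<Sum>b\<in>V - {a}. of_bool ({a, b} \<in> F))
      = real (card (Sigma V (\<lambda>a. {b \<in> V - {a}. {a, b} \<in> F})))"
    using V by (simp add: card_SigmaI of_bool_def sum.If_cases Int_def)
  also have "Sigma V (\<lambda>a. {b \<in> V - {a}. {a, b} \<in> F}) = (\<Union>e\<in>F. {(a, b). {a, b} = e})"
    using mem by auto
  also have "card (\<Union>e\<in>F. {(a, b). {a, b} = e}) = (\<Sum>e\<in>F. card {(a, b). {a, b} = e})"
    using two by (intro card_UN_disjoint[OF finF]) auto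
  also have "\<dots> = (\<Sum>e\<in>F. 2)" using two by (intro sum.cong) auto
  finally show ?thesis by simp
qed

text \<open>The vertices whose matching edge has colour \<open>i\<close> are the disjoint union of
  the matching edges of that colour, two vertices each; this explains the halving in
  \<open>edge_count\<close>.\<close>

lemma pairing_edges:
  assumes V: "finite V" and p: "pairing V p"
  defines "M \<equiv> (\<lambda>a. {a, p a}) ` V"
  shows "perfect_matching V (nsets V 2) M"
    "real (card (colour_class (nsets V 2) c i \<inter> M)) = edge_count V c p i"
proof -
  have edge: "{a, p a} \<in> nsets V 2" if "a \<in> V" for a
    using p that by (auto simp: pairing_def nsets_def)
  have disj: "{a, p a} \<inter> {b, p b} = {}" if "a \<in> V" "b \<in> V" "{a, p a} \<noteq> {b, p b}" for a b
    using p that by (auto simp: pairing_def doubleton_eq_iff) metis+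
  show pm: "perfect_matching V (nsets V 2) M"
    unfolding perfect_matching_def matching_def
  proof (intro conjI)
    show "M \<subseteq> nsets V 2" using edge by (auto simp: M_def)
    show "pairwise disjnt M" using disj by (auto simp: M_def pairwise_def disjnt_def)
    show "\<Union>M = V" using p by (auto simp: M_def pairing_def)
  qed
  define S where "S = colour_class (nsets V 2) c i \<inter> M"
  have S: "S \<subseteq> M" "\<And>e. e \<in> S \<Longrightarrow> card e = 2" "finite S"
    using V by (auto simp: S_def M_def colour_class_def nsets_def)
  have mem: "{a, p a} \<in> S \<longleftrightarrow> c {a, p a} = i" if "a \<in> V" for a
    using edge that by (auto simp: S_def M_def colour_class_def)
  have "{a \<in> V. c {a, p a} = i} = \<Union>S"
  proof (intro equalityI subsetI)
    fix x assume "x \<in> {a \<in> V. c {a, p a} = i}"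
    then show "x \<in> \<Union>S" using mem[of x] by blast
  next
    fix x assume "x \<in> \<Union>S"
    then obtain a where a: "a \<in> V" "x \<in> {a, p a}" "{a, p a} \<in> S" using S(1) by (auto simp: M_def)
    then have "x \<in> V" "{x, p x} = {a, p a}" using p by (auto simp: pairing_def)
    then show "x \<in> {a \<in> V. c {a, p a} = i}" using mem[of x] a by simp
  qed
  moreover have "card (\<Union>S) = (\<Sum>e\<in>S. card e)"
  proof (rule card_Union_disjoint)
    show "pairwise disjnt S"
      using pm S(1) unfolding perfect_matching_def matching_def by (blast intro: pairwise_subset)
    show "\<And>e. e \<in> S \<Longrightarrow> finite e" using S(2) by (metis card.infinite zero_neq_numeral)
  qed
  ultimately have "card {a \<in> V. c {a, p a} = i} = 2 * card S" using S(2) by simp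
  then show "real (card (colour_class (nsets V 2) c i \<inter> M)) = edge_count V c p i"
    unfolding edge_count_def S_def[symmetric]
    using V by (simp add: of_bool_def sum.If_cases Int_def conj_commute)
qed

text \<open>The \<open>k\<close> classes share all edges equally, and \<open>k\<close> cancels.
  Doubled by \<open>count_ordered_pairs\<close>, the result is the form of balance that
  \<open>improve_pairing\<close> expects.\<close>

lemma card_balanced_class:
  assumes col: "edge_colouring (complete_edges (2 * (k * t))) k c"
    and bal: "colour_balanced (complete_edges (2 * (k * t))) k c"
    and i: "i \<in> {1..k}"
  shows "card (colour_class (complete_edges (2 * (k * t))) c i) = t * (2 * (k * t) - 1)"
proof -
  let ?E = "complete_edges (2 * (k * t))"
  have finE: "finite ?E" unfolding complete_edges_def by (rule finite_imp_finite_nsets) simp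
  have "card ?E = (\<Sum>j\<in>{1..k}. card (colour_class ?E c j))"
  proof -
    have "?E = (\<Union>j\<in>{1..k}. colour_class ?E c j)"
      using col by (auto simp: edge_colouring_def colour_class_def Pi_def)
    then have "card ?E = card (\<Union>j\<in>{1..k}. colour_class ?E c j)" by (rule arg_cong)
    also have "\<dots> = (\<Sum>j\<in>{1..k}. card (colour_class ?E c j))"
      using finE by (intro card_UN_disjoint) (auto simp: colour_class_def)
    finally show ?thesis .
  qed
  also have "\<dots> = (\<Sum>j\<in>{1..k}. card (colour_class ?E c i))"
    by (intro sum.cong refl) (use bal i in \<open>unfold colour_balanced_def, blast\<close>)
  finally have "card ?E = k * card (colour_class ?E c i)" by simp
  moreover have "card ?E = (2 * (k * t)) choose 2"
    by (simp add: complete_edges_def card_nsets)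
  moreover have "(2 * (k * t)) choose 2 = k * (t * (2 * (k * t) - 1))"
    by (simp add: choose_two)
  ultimately show ?thesis using i by simp
qed

theorem theorem1p2:
  shows "\<exists>C::real. C > 0 \<and>
    (\<forall>(k::nat) (t::nat) (n::nat) (c :: nat set \<Rightarrow> nat).
       k \<ge> 1 \<longrightarrow> t \<ge> 1 \<longrightarrow> n = k * t \<longrightarrow>
       edge_colouring (complete_edges (2 * n)) k c \<longrightarrow>
       colour_balanced (complete_edges (2 * n)) k c \<longrightarrow>
       (\<exists>M. perfect_matching (complete_verts (2 * n)) (complete_edges (2 * n)) M \<and>
            colour_deviation (complete_edges (2 * n)) k t c M \<le> C * (real k)\<^sup>2))"
proof (intro exI[of _ "680 :: real"] conjI allI impI)
  fix k t n :: nat and c :: "nat set \<Rightarrow> nat"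
  assume k: "k \<ge> 1" and t: "t \<ge> 1" and n: "n = k * t"
    and col: "edge_colouring (complete_edges (2 * n)) k c"
    and bal: "colour_balanced (complete_edges (2 * n)) k c"
  define V where "V = complete_verts (2 * n)"
  have n1: "n \<ge> 1" using k t n by simp
  have V: "finite V" "V \<noteq> {}" "card V = 2 * n" using n1 by (auto simp: V_def)
  have E: "complete_edges (2 * n) = nsets V 2" by (simp add: complete_edges_def V_def)
  \<comment> \<open>The matching of 1 with 2, 3 with 4, and so on, shows that a pairing
    exists.\<close>
  have p0: "pairing V (\<lambda>a. if odd a then a + 1 else a - 1)"
    unfolding pairing_def V_def by (auto elim!: oddE evenE) presburger
  have colI: "\<forall>a\<in>V. \<forall>b\<in>V - {a}. c {a, b} \<in> {1..k}"
    using col unfolding edge_colouring_def E by (auto simp: nsets_def Pi_def)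
  have balI: "\<forall>i\<in>{1..k}. (\<Sum>a\<in>V. \<Sum>b\<in>V - {a}. of_bool (c {a, b} = i))
      = 2 * real t * real (card V - 1)"
  proof
    fix i assume i: "i \<in> {1..k}"
    have "(\<Sum>a\<in>V. \<Sum>b\<in>V - {a}. of_bool (c {a, b} = i))
      = (\<Sum>a\<in>V. \<Sum>b\<in>V - {a}. (of_bool ({a, b} \<in> colour_class (nsets V 2) c i) :: real))"
      by (intro sum.cong) (auto simp: colour_class_def nsets_def)
    also have "\<dots> = 2 * real (card (colour_class (nsets V 2) c i))"
      by (rule count_ordered_pairs[OF V(1)]) (auto simp: colour_class_def)
    also have "card (colour_class (nsets V 2) c i) = t * (card V - 1)"
      using card_balanced_class[of k t c i] col bal i unfolding n[symmetric] E V(3) by simp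
    finally show "(\<Sum>a\<in>V. \<Sum>b\<in>V - {a}. of_bool (c {a, b} = i)) = 2 * real t * real (card V - 1)"
      by simp
  qed
  obtain p where p: "pairing V p" "deviation {1..k} (real t) V c p \<le> 680 * (real k)\<^sup>2"
    using small_deviation_pairing[OF V(1,2) _ _ colI balI p0] k by auto
  have "colour_deviation (nsets V 2) k t c ((\<lambda>a. {a, p a}) ` V) = deviation {1..k} (real t) V c p"
    by (simp add: colour_deviation_def deviation_def pairing_edges(2)[OF V(1) p(1)])
  then show "\<exists>M. perfect_matching (complete_verts (2 * n)) (complete_edges (2 * n)) M \<and>
      colour_deviation (complete_edges (2 * n)) k t c M \<le> 680 * (real k)\<^sup>2"
    using pairing_edges(1)[OF V(1) p(1)] p(2) unfolding E V_def[symmetric] by auto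
qed simp

end
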